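(* Consider $\mathbb{Z}_q$--synchronization with noise parameter $p$ and with side information from $\mathrm{BEC}(1-\varepsilon)$ on a random $k$-regular graph $G_n$. There exist constants $c=c(k,p,q)$ and $C=C(k,p,q)$ (positive) such that the following holds. If $(1-p)^2(k-1)<1$ and $\varepsilon\le c$ then $$\limsup_{l\to\infty}\limsup_{n\to\infty}\frac1n\sum_{u\in V_n}\mathbb{E}\big[d_{\mathrm{TV}}(\widehat\mu_{G_n,u,l},\bar\nu)^2\big]\le C\varepsilon.$$
   Context: $G_n=(V_n,E_n)$ is uniformly distributed over $k$-regular graphs on $n$ vertices ($k$ fixed, $nk$ even), with edges directed arbitrarily (ordered pairs). **$\mathbb{Z}_q$--synchronization:** $(\theta_u)_{u\in V_n}$ are i.i.d. uniform in $\mathbb{Z}_q=\mathbb{Z}/q\mathbb{Z}$; for each edge $(u,v)\in E_n$, $Y_{uv}=\theta_u-\theta_v\ (\mathrm{mod}\ q)$ with probability $1-p$ and $Y_{uv}=w_{uv}$ with probability $p$, where the $w_{uv}$ are i.i.d. uniform on $\mathbb{Z}_q$, independent of $\theta$, everything being independent across edges given $\theta$. **Side information from $\mathrm{BEC}(1-\varepsilon)$:** independently for each vertex (and of the rest), $\xi_u^{(\varepsilon)}=\theta_u$ with probability $\varepsilon$ and $\xi_u^{(\varepsilon)}=\star$ (a symbol not in $\mathbb{Z}_q$) with probability $1-\varepsilon$. $B_{G_n}(u,l)$ is the ball of radius $l$ around $u$ in graph distance; $Y^{(\varepsilon)}_{B_{G_n}(u,l)}$ is the collection of all $Y_{vw}$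 on edges with both endpoints in the ball and all $\xi_v^{(\varepsilon)}$ for $v$ in the ball; $\widehat\mu_{G_n,u,l}(x)=\mathbb{P}(\theta_u=x\mid Y^{(\varepsilon)}_{B_{G_n}(u,l)})$, $x\in\mathbb{Z}_q$. $\bar\nu$ is the uniform distribution on $\mathbb{Z}_q$; $d_{\mathrm{TV}}$ is total variation distance. The expectation is over all randomness. *)

theory Defs
  imports "HOL-Probability.Probability" "HOL-Library.Extended_Nat"
begin

text \<open>Graphs have vertex set \<open>{..<n}\<close>. A simple undirected graph is given by its adjacency
  relation, which contains both \<open>(u, v)\<close> and \<open>(v, u)\<close> for every edge.\<close>

definition regular_graphs :: "nat \<Rightarrow> nat \<Rightarrow> nat rel set" where
  "regular_graphs n k =
    {E. E \<subseteq> {..<n} \<times> {..<n} \<and> sym E \<and> irrefl E \<and> (\<forall>u<n. card (E `` {u}) = k)}"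

definition orientation_of :: "nat rel \<Rightarrow> nat rel \<Rightarrow> bool" where
  "orientation_of E D \<longleftrightarrow> D \<union> D\<inverse> = E \<and> D \<inter> D\<inverse> = {}"

text \<open>The infimum over the empty set is \<open>\<infinity>\<close>, so vertices in different components are at
  infinite distance.\<close>

definition graph_dist :: "nat rel \<Rightarrow> nat \<Rightarrow> nat \<Rightarrow> enat" where
  "graph_dist E u v = (INF m\<in>{m. (u, v) \<in> E ^^ m}. enat m)"

definition graph_ball :: "nat rel \<Rightarrow> nat \<Rightarrow> nat \<Rightarrow> nat set" where
  "graph_ball E u l = {v. graph_dist E u v \<le> enat l}"

text \<open>\<open>\<int>/q\<int>\<close> is represented by the residues \<open>0, \<dots>, q - 1\<close>.\<close>

definition Zmod :: "nat \<Rightarrow> int set" where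
  "Zmod q = {0..<int q}"

definition edge_channel :: "nat \<Rightarrow> real \<Rightarrow> int \<Rightarrow> int \<Rightarrow> int pmf" where
  "edge_channel q p a b =
    do { noisy \<leftarrow> bernoulli_pmf p;
         if noisy then pmf_of_set (Zmod q) else return_pmf ((a - b) mod int q) }"

text \<open>The parameter is the probability that the symbol is revealed;
  \<^const>\<open>None\<close> is the erasure symbol.\<close>

definition erasure_channel :: "real \<Rightarrow> int \<Rightarrow> int option pmf" where
  "erasure_channel \<epsilon> a =
    do { revealed \<leftarrow> bernoulli_pmf \<epsilon>; return_pmf (if revealed then Some a else None) }"

text \<open>A sample \<open>(\<theta>, Y, \<xi>)\<close> consists of the vertex labels, the observations on the directed
  edges, and the side information. The values of these functions outside the vertices and the
  directed edges are irrelevant constants.\<close>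

type_synonym sample = "(nat \<Rightarrow> int) \<times> (nat \<times> nat \<Rightarrow> int) \<times> (nat \<Rightarrow> int option)"

definition sync_pmf :: "nat \<Rightarrow> real \<Rightarrow> real \<Rightarrow> nat \<Rightarrow> nat rel \<Rightarrow> sample pmf" where
  "sync_pmf q p \<epsilon> n D =
    do { \<theta> \<leftarrow> Pi_pmf {..<n} 0 (\<lambda>_. pmf_of_set (Zmod q));
         Y \<leftarrow> Pi_pmf D 0 (\<lambda>(u, v). edge_channel q p (\<theta> u) (\<theta> v));
         \<xi> \<leftarrow> Pi_pmf {..<n} None (\<lambda>u. erasure_channel \<epsilon> (\<theta> u));
         return_pmf (\<theta>, Y, \<xi>) }"

definition labels :: "sample \<Rightarrow> nat \<Rightarrow> int" where
  "labels = fst"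

definition local_obs ::
    "nat rel \<Rightarrow> nat rel \<Rightarrow> nat \<Rightarrow> nat \<Rightarrow> sample \<Rightarrow> (nat \<times> nat \<Rightarrow> int) \<times> (nat \<Rightarrow> int option)" where
  "local_obs E D u l = (\<lambda>(\<theta>, Y, \<xi>).
     (restrict Y (D \<inter> graph_ball E u l \<times> graph_ball E u l), restrict \<xi> (graph_ball E u l)))"

text \<open>The posterior is conditional on the observed value in the sample \<open>\<omega>\<close>. As \<open>\<omega>\<close> ranges
  over the support of a discrete law, the conditioning event has positive probability.\<close>

definition posterior ::
    "nat \<Rightarrow> real \<Rightarrow> real \<Rightarrow> nat \<Rightarrow> nat rel \<Rightarrow> nat rel \<Rightarrow> nat \<Rightarrow> nat \<Rightarrow> sample \<Rightarrow> int \<Rightarrow> real" where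
  "posterior q p \<epsilon> n E D u l \<omega> x =
    \<P>(\<omega>' in measure_pmf (sync_pmf q p \<epsilon> n D).
      labels \<omega>' u = x \<bar> local_obs E D u l \<omega>' = local_obs E D u l \<omega>)"

definition d_TV :: "'a set \<Rightarrow> ('a \<Rightarrow> real) \<Rightarrow> ('a \<Rightarrow> real) \<Rightarrow> real" where
  "d_TV A \<mu> \<nu> = (\<Sum>x\<in>A. \<bar>\<mu> x - \<nu> x\<bar>) / 2"

definition random_regular_sync_pmf ::
    "nat \<Rightarrow> nat \<Rightarrow> real \<Rightarrow> real \<Rightarrow> nat \<Rightarrow> (nat rel \<Rightarrow> nat rel) \<Rightarrow> (nat rel \<times> sample) pmf" where
  "random_regular_sync_pmf k q p \<epsilon> n dir =
    do { E \<leftarrow> pmf_of_set (regular_graphs n k);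
         \<omega> \<leftarrow> sync_pmf q p \<epsilon> n (dir E);
         return_pmf (E, \<omega>) }"

definition mean_square_TV ::
    "nat \<Rightarrow> nat \<Rightarrow> real \<Rightarrow> real \<Rightarrow> nat \<Rightarrow> (nat rel \<Rightarrow> nat rel) \<Rightarrow> nat \<Rightarrow> real" where
  "mean_square_TV k q p \<epsilon> n dir l =
    1 / real n * (\<Sum>u<n. measure_pmf.expectation (random_regular_sync_pmf k q p \<epsilon> n dir)
      (\<lambda>(E, \<omega>). (d_TV (Zmod q) (posterior q p \<epsilon> n E (dir E) u l \<omega>) (pmf (pmf_of_set (Zmod q))))\<^sup>2))"

text \<open>Sizes \<open>n\<close> tending to infinity along even \<open>n * k\<close>; these include all \<open>n\<close> for which a
  \<open>k\<close>-regular graph on \<open>n\<close> vertices exists, and \<^const>\<open>regular_graphs\<close> is nonempty for all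
  such \<open>n > k\<close>.\<close>

definition admissible_sizes :: "nat \<Rightarrow> nat filter" where
  "admissible_sizes k = inf sequentially (principal {n. even (n * k)})"

end

theory Submission
  imports Defs
begin

text \<open>The squared total variation distance between the posterior of \<open>\<theta>\<^sub>u\<close> and the uniform law is at most
the \<open>\<chi>\<^sup>2\<close>-divergence between them, and the expectation of the latter is a functional \<open>chi2\<close> of the
channel that takes a uniform label \<open>x\<close> to the law of the observations given \<open>\<theta>\<^sub>u = x\<close>. This functional
behaves well under the operations that build the observations on a tree:

\<^item> processing the observations never increases it (\<open>chi2_map_le\<close>);
\<^item> passing through one edge of the model multiplies it by \<open>(1 - p)\<^sup>2\<close> (\<open>chi2_noisy_edge\<close>);
\<^item> revealing the label with probability \<open>\<epsilon>\<close> adds at most \<open>\<epsilon> q\<close> (\<open>chi2_reveal_le\<close>);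
\<^item> for two observations that are independent given the label it is additive to first order: the value
  for the pair exceeds the sum of the two values \<open>a\<close>, \<open>b\<close> at most by a factor \<open>1 + \<eta>\<close>, once \<open>b\<close> is
  small in terms of \<open>\<eta>\<close> (\<open>chi2_pair_small\<close>).

On a tree in which every vertex has at most \<open>k - 1\<close> children, one level therefore acts on small values
like \<open>a \<mapsto> \<epsilon> q + (1 + \<eta>)^(k - 1) (k - 1) (1 - p)\<^sup>2 a\<close>. If \<open>(k - 1) (1 - p)\<^sup>2 < 1\<close>, then for small \<open>\<eta>\<close> this map is
a contraction with a fixed point proportional to \<open>\<epsilon>\<close>. For small \<open>\<epsilon>\<close> the fixed point lies in the range
where first-order additivity is available, so induction from the leaves bounds \<open>chi2\<close> at every vertex
by a multiple of \<open>\<epsilon>\<close>, whatever the depth. This is where the Kesten-Stigum condition and the smallness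
of \<open>\<epsilon>\<close> enter.

It remains to see that for fixed \<open>l\<close> all but a vanishing fraction of the balls of radius \<open>l\<close> are trees.
If a ball around \<open>u\<close> is not a tree, there are two walks from \<open>u\<close> of length at most \<open>l\<close> whose ends are
joined by an edge that neither of them uses. Once the walks are given, a switching argument shows that
this additional edge is present with probability \<open>O(1/n)\<close> (\<open>extra_edge_rare\<close>), and in a graph of degree
\<open>k\<close> boundedly many such pairs of walks start at \<open>u\<close>. So a ball fails to be a tree with probability \<open>O(1/n)\<close>
(\<open>near_cycle_probability_le\<close>), and this contribution disappears as \<open>n\<close> tends to infinity.\<close>

section \<open>The \<open>\<chi>\<^sup>2\<close>-information of a channel\<close>

text \<open>A channel is a family \<open>M\<close> of laws indexed by the label \<open>x\<close>. Its output under a uniform label has law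
\<open>mixture q M\<close>, and the posterior of \<open>x\<close> given the output \<open>z\<close> is \<open>(1 + excess q M x z) / q\<close>. Thus
\<open>chi2\<close> is the expected \<open>\<chi>\<^sup>2\<close>-divergence of the posterior from the uniform law.\<close>

definition mixture :: "nat \<Rightarrow> (int \<Rightarrow> 'z pmf) \<Rightarrow> 'z pmf" where
  "mixture q M = bind_pmf (pmf_of_set (Zmod q)) M"

definition excess :: "nat \<Rightarrow> (int \<Rightarrow> 'z pmf) \<Rightarrow> int \<Rightarrow> 'z \<Rightarrow> real" where
  "excess q M x z = pmf (M x) z / pmf (mixture q M) z - 1"

definition chi2 :: "nat \<Rightarrow> (int \<Rightarrow> 'z pmf) \<Rightarrow> real" where
  "chi2 q M = measure_pmf.expectation (mixture q M)
     (\<lambda>z. (\<Sum>x\<in>Zmod q. (excess q M x z)\<^sup>2) / real q)"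

lemma Zmod_simps [simp]: "finite (Zmod q)" "card (Zmod q) = q" "Zmod q = {} \<longleftrightarrow> q = 0"
  by (auto simp: Zmod_def)

lemma set_pmf_Zmod: "0 < q \<Longrightarrow> set_pmf (pmf_of_set (Zmod q)) = Zmod q"
  by (subst set_pmf_of_set) auto

lemma pmf_mixture: "0 < q \<Longrightarrow> pmf (mixture q M) z = (\<Sum>x\<in>Zmod q. pmf (M x) z) / real q"
  unfolding mixture_def by (subst pmf_bind_pmf_of_set) auto

lemma set_pmf_mixture: "0 < q \<Longrightarrow> set_pmf (mixture q M) = (\<Union>x\<in>Zmod q. set_pmf (M x))"
  by (simp add: mixture_def set_pmf_Zmod)

lemma finite_mixture:
  "0 < q \<Longrightarrow> (\<And>x. x \<in> Zmod q \<Longrightarrow> finite (set_pmf (M x))) \<Longrightarrow> finite (set_pmf (mixture q M))"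
  by (simp add: set_pmf_mixture)

lemma chi2_sum:
  assumes "finite A" "set_pmf (mixture q M) \<subseteq> A"
  shows "chi2 q M =
    (\<Sum>z\<in>A. pmf (mixture q M) z * ((\<Sum>x\<in>Zmod q. (excess q M x z)\<^sup>2) / real q))"
  unfolding chi2_def using assms by (subst integral_measure_pmf_real[of A]) (auto simp: mult.commute)

lemma chi2_nonneg: "0 \<le> chi2 q M"
  unfolding chi2_def by (intro integral_nonneg_AE AE_I2 divide_nonneg_nonneg sum_nonneg) auto

text \<open>At outputs of probability zero \<open>excess\<close> takes the default value \<open>- 1\<close>, and both sides vanish.\<close>

lemma pmf_excess:
  assumes "0 < q" "x \<in> Zmod q"
  shows "pmf (M x) z = pmf (mixture q M) z * (1 + excess q M x z)"
proof (cases "pmf (mixture q M) z = 0")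
  case True
  then have "z \<notin> set_pmf (mixture q M)" by (simp add: set_pmf_eq)
  then have "z \<notin> set_pmf (M x)" using assms by (auto simp: set_pmf_mixture)
  then show ?thesis using True by (simp add: set_pmf_eq)
qed (simp add: excess_def)

lemma sum_excess:
  assumes "0 < q" "z \<in> set_pmf (mixture q M)"
  shows "(\<Sum>x\<in>Zmod q. excess q M x z) = 0"
proof -
  have "pmf (mixture q M) z \<noteq> 0" using assms by (simp add: set_pmf_eq)
  then show ?thesis using assms
    by (simp add: excess_def sum_subtractf flip: sum_divide_distrib)
       (simp add: pmf_mixture)
qed

lemma excess_ge: "- 1 \<le> excess q M x z"
  by (simp add: excess_def)

lemma weighted_Cauchy_Schwarz:
  fixes m e :: "'a \<Rightarrow> real"
  assumes "\<And>z. z \<in> A \<Longrightarrow> 0 \<le> m z"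
  shows "(\<Sum>z\<in>A. m z * e z)\<^sup>2 \<le> (\<Sum>z\<in>A. m z) * (\<Sum>z\<in>A. m z * (e z)\<^sup>2)"
proof -
  have "(\<Sum>z\<in>A. sqrt (m z) * (sqrt (m z) * e z))\<^sup>2
      \<le> (\<Sum>z\<in>A. (sqrt (m z))\<^sup>2) * (\<Sum>z\<in>A. (sqrt (m z) * e z)\<^sup>2)"
    by (rule Cauchy_Schwarz_ineq_sum)
  also have "(\<Sum>z\<in>A. sqrt (m z) * (sqrt (m z) * e z)) = (\<Sum>z\<in>A. m z * e z)"
    using assms by (intro sum.cong) (auto simp flip: mult.assoc)
  also have "(\<Sum>z\<in>A. (sqrt (m z))\<^sup>2) = (\<Sum>z\<in>A. m z)"
    using assms by (intro sum.cong) auto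
  also have "(\<Sum>z\<in>A. (sqrt (m z) * e z)\<^sup>2) = (\<Sum>z\<in>A. m z * (e z)\<^sup>2)"
    using assms by (intro sum.cong) (auto simp: power_mult_distrib)
  finally show ?thesis .
qed

lemma pmf_map_sum:
  assumes "finite A" "set_pmf P \<subseteq> A"
  shows "pmf (map_pmf h P) w = (\<Sum>z\<in>{z\<in>A. h z = w}. pmf P z)"
proof -
  have "pmf (map_pmf h P) w = measure P (h -` {w})" by (simp add: pmf_map)
  also have "\<dots> = measure P {z\<in>A. h z = w}"
    using assms by (intro measure_eq_AE) (auto simp: AE_measure_pmf_iff)
  also have "\<dots> = (\<Sum>z\<in>{z\<in>A. h z = w}. pmf P z)"
    using assms by (subst measure_measure_pmf_finite) auto
  finally show ?thesis .
qed

text \<open>The data-processing inequality. Every posterior after processing is a weighted mean of posteriors before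
it, and squaring is convex. Below it replaces all bookkeeping on how observations are encoded.\<close>

lemma chi2_map_le:
  assumes q: "0 < q" and fin: "\<And>x. x \<in> Zmod q \<Longrightarrow> finite (set_pmf (M x))"
  shows "chi2 q (\<lambda>x. map_pmf h (M x)) \<le> chi2 q M"
proof -
  define A where "A = set_pmf (mixture q M)"
  define M' where "M' = (\<lambda>x. map_pmf h (M x))"
  let ?m = "pmf (mixture q M)"
  let ?m' = "pmf (mixture q M')"
  have finA: "finite A" unfolding A_def by (rule finite_mixture[OF q fin])
  have mix: "mixture q M' = map_pmf h (mixture q M)"
    by (simp add: mixture_def M'_def map_bind_pmf)
  have sub: "set_pmf (M x) \<subseteq> A" if "x \<in> Zmod q" for x
    using that q by (auto simp: A_def set_pmf_mixture)
  have m': "?m' w = (\<Sum>z\<in>{z\<in>A. h z = w}. ?m z)" for w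
    unfolding mix by (rule pmf_map_sum[OF finA]) (simp add: A_def)
  have point: "?m' w * (excess q M' x w)\<^sup>2 \<le> (\<Sum>z\<in>{z\<in>A. h z = w}. ?m z * (excess q M x z)\<^sup>2)"
    if x: "x \<in> Zmod q" for x w
  proof (cases "?m' w = 0")
    case True
    then show ?thesis by (auto intro!: sum_nonneg)
  next
    case False
    then have pos: "0 < ?m' w" by (simp add: less_le)
    have "?m' w * (1 + excess q M' x w) = pmf (M' x) w"
      using pmf_excess[OF q x, of M' w] by simp
    also have "\<dots> = (\<Sum>z\<in>{z\<in>A. h z = w}. pmf (M x) z)"
      unfolding M'_def by (rule pmf_map_sum[OF finA sub[OF x]])
    also have "\<dots> = (\<Sum>z\<in>{z\<in>A. h z = w}. ?m z * (1 + excess q M x z))"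
      by (intro sum.cong refl pmf_excess[OF q x])
    finally have "?m' w * excess q M' x w = (\<Sum>z\<in>{z\<in>A. h z = w}. ?m z * excess q M x z)"
      using m'[of w] by (simp add: algebra_simps sum.distrib)
    then have "(?m' w * excess q M' x w)\<^sup>2 \<le> ?m' w * (\<Sum>z\<in>{z\<in>A. h z = w}. ?m z * (excess q M x z)\<^sup>2)"
      using weighted_Cauchy_Schwarz[of "{z\<in>A. h z = w}" ?m "excess q M x"] m'[of w] by simp
    then have "?m' w * (?m' w * (excess q M' x w)\<^sup>2) \<le> ?m' w * (\<Sum>z\<in>{z\<in>A. h z = w}. ?m z * (excess q M x z)\<^sup>2)"
      by (simp only: power_mult_distrib power2_eq_square[of "?m' w"] mult.assoc)
    then show ?thesis using pos by (simp only: mult_le_cancel_left_pos)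
  qed
  have "chi2 q M' = (\<Sum>w\<in>h ` A. ?m' w * ((\<Sum>x\<in>Zmod q. (excess q M' x w)\<^sup>2) / real q))"
    by (rule chi2_sum) (use finA in \<open>auto simp: mix A_def\<close>)
  also have "\<dots> = (\<Sum>w\<in>h ` A. \<Sum>x\<in>Zmod q. ?m' w * (excess q M' x w)\<^sup>2) / real q"
    by (simp add: sum_divide_distrib sum_distrib_left)
  also have "\<dots> \<le> (\<Sum>w\<in>h ` A. \<Sum>x\<in>Zmod q. \<Sum>z\<in>{z\<in>A. h z = w}. ?m z * (excess q M x z)\<^sup>2) / real q"
    by (intro divide_right_mono sum_mono point) auto
  also have "(\<Sum>w\<in>h ` A. \<Sum>x\<in>Zmod q. \<Sum>z\<in>{z\<in>A. h z = w}. ?m z * (excess q M x z)\<^sup>2)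
     = (\<Sum>w\<in>h ` A. \<Sum>z\<in>{z\<in>A. h z = w}. \<Sum>x\<in>Zmod q. ?m z * (excess q M x z)\<^sup>2)"
    by (intro sum.cong refl) (rule sum.swap)
  also have "\<dots> = (\<Sum>z\<in>A. \<Sum>x\<in>Zmod q. ?m z * (excess q M x z)\<^sup>2)"
    using sum.image_gen[OF finA, of "\<lambda>z. \<Sum>x\<in>Zmod q. ?m z * (excess q M x z)\<^sup>2" h] by simp
  also have "\<dots> / real q = chi2 q M"
    by (subst chi2_sum[OF finA]) (auto simp: A_def sum_divide_distrib sum_distrib_left)
  finally show ?thesis unfolding M'_def .
qed

text \<open>The pointwise estimate behind merging two observations. Here \<open>1 + f\<close> and \<open>1 + g\<close> are the likelihood
ratios of the two outputs, \<open>L\<close> is the ratio of the pair with respect to the product of the two output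
laws, and \<open>t\<close> is its mean, that is, the density of the joint output law. The left-hand side is the
contribution of the pair to \<open>\<chi>\<^sup>2\<close>, which carries a factor \<open>1 / t\<close>. Because \<open>f\<close> and \<open>g\<close> have mean zero,
\<open>t - 1\<close> is the mean of \<open>f g\<close>, hence of second order: \<open>1 / t\<close> is replaced by \<open>1 + \<delta>\<close> at the price of a
multiple of \<open>(t - 1)\<^sup>2\<close>, which by Cauchy-Schwarz is bounded by the product of the two mean squares.\<close>

lemma merged_posterior_bound:
  fixes f g :: "'a \<Rightarrow> real" and \<delta> :: real
  assumes X: "finite X" "card X = q" "0 < q" and \<delta>: "0 < \<delta>"
    and f0: "(\<Sum>x\<in>X. f x) = 0" and g0: "(\<Sum>x\<in>X. g x) = 0"
    and f1: "\<And>x. x \<in> X \<Longrightarrow> - 1 \<le> f x" and g1: "\<And>x. x \<in> X \<Longrightarrow> - 1 \<le> g x"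
  defines "L \<equiv> \<lambda>x. (1 + f x) * (1 + g x)"
  defines "t \<equiv> (\<Sum>x\<in>X. L x) / real q"
  shows "t * ((\<Sum>x\<in>X. (L x / t - 1)\<^sup>2) / real q)
    \<le> (1 + \<delta>) * ((\<Sum>x\<in>X. (L x - 1)\<^sup>2) / real q)
      + (1 + \<delta>)\<^sup>2 / (4 * \<delta>) * (real q)\<^sup>2 * (((\<Sum>x\<in>X. (f x)\<^sup>2) / real q) * ((\<Sum>x\<in>X. (g x)\<^sup>2) / real q))"
proof (cases "t = 0")
  case True
  then show ?thesis using \<delta> by (auto intro!: add_nonneg_nonneg mult_nonneg_nonneg divide_nonneg_nonneg sum_nonneg)
next
  case False
  define K where "K = (1 + \<delta>)\<^sup>2 / (4 * \<delta>)"
  have K: "0 \<le> K" using \<delta> by (simp add: K_def)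
  have L0: "0 \<le> L x" if "x \<in> X" for x
    using f1[OF that] g1[OF that] by (simp add: L_def)
  have "0 \<le> t" unfolding t_def using L0 by (intro divide_nonneg_nonneg sum_nonneg) auto
  then have t0: "0 < t" using False by simp
  have sumL: "(\<Sum>x\<in>X. L x) = real q * t" using X by (simp add: t_def)
  have t1: "t - 1 = (\<Sum>x\<in>X. f x * g x) / real q"
  proof -
    have "(\<Sum>x\<in>X. L x) = real q + (\<Sum>x\<in>X. f x * g x)"
      using X f0 g0 by (simp add: L_def algebra_simps sum.distrib)
    then show ?thesis using X by (simp add: t_def field_simps)
  qed
  have tsq: "(t - 1)\<^sup>2 \<le> ((\<Sum>x\<in>X. (f x)\<^sup>2) / real q) * ((\<Sum>x\<in>X. (g x)\<^sup>2) / real q)"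
    using Cauchy_Schwarz_ineq_sum[of f g X] X
    by (simp add: t1 power_divide divide_right_mono flip: power2_eq_square)
  have le_sum: "h x \<le> (\<Sum>x\<in>X. h x)" if "x \<in> X" "\<And>x. x \<in> X \<Longrightarrow> 0 \<le> h x" for h :: "'a \<Rightarrow> real" and x
    using member_le_sum[of x X h] that X by auto
  have fq: "1 + f x \<le> real q" if "x \<in> X" for x
    using le_sum[OF that, of "\<lambda>x. 1 + f x"] f1 f0 X by (force simp: sum.distrib)
  have tq: "t \<le> real q"
  proof -
    have "(\<Sum>x\<in>X. L x) \<le> (\<Sum>x\<in>X. real q * (1 + g x))"
      unfolding L_def using fq g1 by (intro sum_mono mult_right_mono) force+
    also have "\<dots> = real q * real q"
      using g0 X by (simp add: sum.distrib flip: sum_distrib_left)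
    finally show ?thesis using X by (simp add: t_def field_simps)
  qed
  define V where "V = (\<Sum>x\<in>X. (L x - t)\<^sup>2) / real q"
  have V0: "0 \<le> V" by (simp add: V_def sum_nonneg)
  \<comment> \<open>The sum of squared deviations is smallest around the mean \<open>t\<close>.\<close>
  have Vexp: "(\<Sum>x\<in>X. (L x - s)\<^sup>2) = (\<Sum>x\<in>X. (L x)\<^sup>2) - 2 * s * (real q * t) + real q * s\<^sup>2" for s
    using X sumL by (simp add: power2_diff sum.distrib sum_subtractf sum_distrib_left[symmetric] sum_distrib_right[symmetric] mult.assoc)
  have V1: "V \<le> (\<Sum>x\<in>X. (L x - 1)\<^sup>2) / real q"
  proof -
    have "0 \<le> real q * (t - 1)\<^sup>2" by simp
    then have "(\<Sum>x\<in>X. (L x - t)\<^sup>2) \<le> (\<Sum>x\<in>X. (L x - 1)\<^sup>2)"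
      unfolding Vexp by (simp add: power2_eq_square algebra_simps)
    then show ?thesis unfolding V_def by (rule divide_right_mono) simp
  qed
  have V2: "V / t \<le> (real q)\<^sup>2"
  proof -
    \<comment> \<open>Each \<open>L x\<close> is at most the sum \<open>q t\<close> of all of them.\<close>
    have "(\<Sum>x\<in>X. (L x)\<^sup>2) \<le> (\<Sum>x\<in>X. L x * (real q * t))"
      unfolding power2_eq_square using L0 le_sum[of _ L] sumL
      by (intro sum_mono mult_left_mono) auto
    also have "\<dots> = (real q * t)\<^sup>2"
      by (simp add: sumL power2_eq_square flip: sum_distrib_right)
    finally have "(\<Sum>x\<in>X. (L x)\<^sup>2) \<le> (real q * t)\<^sup>2" .
    then have "(\<Sum>x\<in>X. (L x - t)\<^sup>2) \<le> (real q * t)\<^sup>2 - real q * t\<^sup>2"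
      unfolding Vexp by (simp add: power2_eq_square algebra_simps)
    also have "\<dots> \<le> real q * (t * (real q * t))"
      using X t0 by (simp add: power2_eq_square algebra_simps)
    finally have "V \<le> t * (real q * t)"
      using X by (simp add: V_def field_simps)
    also have "\<dots> \<le> t * (real q * real q)"
      using t0 tq by (intro mult_left_mono) auto
    finally show ?thesis using t0 by (simp add: field_simps power2_eq_square)
  qed
  \<comment> \<open>\<open>K\<close> makes the discriminant of \<open>K s\<^sup>2 + (1 + \<delta>) s + \<delta>\<close> vanish, where \<open>s = t - 1\<close>.\<close>
  have "0 \<le> 4 * \<delta> * (K * (t - 1)\<^sup>2 + (1 + \<delta>) * (t - 1) + \<delta>)"
  proof -
    have "4 * \<delta> * (K * (t - 1)\<^sup>2 + (1 + \<delta>) * (t - 1) + \<delta>) = ((1 + \<delta>) * (t - 1) + 2 * \<delta>)\<^sup>2"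
      using \<delta> by (simp add: K_def field_simps power2_eq_square)
    then show ?thesis by simp
  qed
  moreover have "0 < 4 * \<delta>" using \<delta> by simp
  ultimately have "0 \<le> K * (t - 1)\<^sup>2 + (1 + \<delta>) * (t - 1) + \<delta>"
    by (metis zero_le_mult_iff not_less)
  then have "1 \<le> (1 + \<delta>) * t + K * (t - 1)\<^sup>2" by (simp add: ring_distribs)
  then have "V / t * 1 \<le> V / t * ((1 + \<delta>) * t + K * (t - 1)\<^sup>2)"
    using V0 t0 by (intro mult_left_mono) auto
  also have "\<dots> = (1 + \<delta>) * V + K * ((V / t) * (t - 1)\<^sup>2)"
    using t0 by (simp add: field_simps)
  also have "\<dots> \<le> (1 + \<delta>) * ((\<Sum>x\<in>X. (L x - 1)\<^sup>2) / real q)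
      + K * ((real q)\<^sup>2 * (((\<Sum>x\<in>X. (f x)\<^sup>2) / real q) * ((\<Sum>x\<in>X. (g x)\<^sup>2) / real q)))"
    using \<delta> K V1 V2 tsq V0 t0 by (intro add_mono mult_left_mono mult_mono) auto
  finally have main: "V / t \<le> (1 + \<delta>) * ((\<Sum>x\<in>X. (L x - 1)\<^sup>2) / real q)
      + K * ((real q)\<^sup>2 * (((\<Sum>x\<in>X. (f x)\<^sup>2) / real q) * ((\<Sum>x\<in>X. (g x)\<^sup>2) / real q)))"
    by simp
  have "(\<Sum>x\<in>X. (L x / t - 1)\<^sup>2) = (\<Sum>x\<in>X. (L x - t)\<^sup>2 / t\<^sup>2)"
    using t0 by (intro sum.cong refl) (simp add: diff_divide_distrib flip: power_divide)
  then have "t * ((\<Sum>x\<in>X. (L x / t - 1)\<^sup>2) / real q) = V / t"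
    using t0 by (simp add: V_def power2_eq_square flip: sum_divide_distrib)
  then show ?thesis using main by (simp add: K_def mult.assoc)
qed

text \<open>Integrate the pointwise estimate against the product of the two output laws. Under this product the two
likelihood ratios are independent with mean one for every fixed \<open>x\<close>, so that
\<open>E (L x - 1)\<^sup>2 = a x + b x + a x * b x\<close>, where \<open>a x\<close> and \<open>b x\<close> are the variances of the ratios at \<open>x\<close>. The
averages of \<open>a\<close> and \<open>b\<close> over \<open>x\<close> are the two values of \<open>chi2\<close>; the factor \<open>q\<close> comes from \<open>a x \<le> q chi2\<close>.\<close>

lemma chi2_pair_le:
  assumes q: "0 < q" and \<delta>: "0 < \<delta>"
    and fM: "\<And>x. x \<in> Zmod q \<Longrightarrow> finite (set_pmf (M x))"
    and fN: "\<And>x. x \<in> Zmod q \<Longrightarrow> finite (set_pmf (N x))"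
  shows "chi2 q (\<lambda>x. pair_pmf (M x) (N x)) \<le> (1 + \<delta>) * (chi2 q M + chi2 q N)
     + ((1 + \<delta>) * real q + (1 + \<delta>)\<^sup>2 / (4 * \<delta>) * (real q)\<^sup>2) * (chi2 q M * chi2 q N)"
proof -
  define A where "A = set_pmf (mixture q M)"
  define B where "B = set_pmf (mixture q N)"
  define P where "P = (\<lambda>x. pair_pmf (M x) (N x))"
  define m n where "m = pmf (mixture q M)" and "n = pmf (mixture q N)"
  define f g where "f = excess q M" and "g = excess q N"
  define K where "K = (1 + \<delta>)\<^sup>2 / (4 * \<delta>) * (real q)\<^sup>2"
  define sqf where "sqf = (\<lambda>z. (\<Sum>x\<in>Zmod q. (f x z)\<^sup>2) / real q)"
  define sqg where "sqg = (\<lambda>z. (\<Sum>x\<in>Zmod q. (g x z)\<^sup>2) / real q)"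
  have fin: "finite A" "finite B" unfolding A_def B_def by (auto intro!: finite_mixture q fM fN)
  have Msum: "pmf (M x) z = m z * (1 + f x z)" if "x \<in> Zmod q" for x z
    unfolding m_def f_def by (rule pmf_excess[OF q that])
  have Nsum: "pmf (N x) z = n z * (1 + g x z)" if "x \<in> Zmod q" for x z
    unfolding n_def g_def by (rule pmf_excess[OF q that])
  have supM: "set_pmf (M x) \<subseteq> A" and supN: "set_pmf (N x) \<subseteq> B" if "x \<in> Zmod q" for x
    using that q by (auto simp: A_def B_def set_pmf_mixture)
  have m1: "(\<Sum>z\<in>A. m z) = 1" "(\<Sum>z\<in>B. n z) = 1"
    using fin unfolding m_def n_def by (auto intro!: sum_pmf_eq_1 simp: A_def B_def)
  have m0: "0 \<le> m z" "0 \<le> n z'" for z z' by (auto simp: m_def n_def)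
  have mpos: "m z \<noteq> 0" if "z \<in> A" for z using that by (simp add: A_def m_def set_pmf_eq)
  have npos: "n z \<noteq> 0" if "z \<in> B" for z using that by (simp add: B_def n_def set_pmf_eq)
  define L where "L = (\<lambda>z1 z2 x. (1 + f x z1) * (1 + g x z2))"
  define t where "t = (\<lambda>z1 z2. (\<Sum>x\<in>Zmod q. L z1 z2 x) / real q)"
  have Px: "pmf (P x) (z1, z2) = m z1 * n z2 * L z1 z2 x" if "x \<in> Zmod q" for x z1 z2
    unfolding P_def pmf_pair Msum[OF that] Nsum[OF that] L_def by simp
  have Pmix: "pmf (mixture q P) (z1, z2) = m z1 * n z2 * t z1 z2" for z1 z2
    unfolding pmf_mixture[OF q] t_def by (simp add: Px sum_distrib_left)
  have sup: "set_pmf (mixture q P) \<subseteq> A \<times> B"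
    using supM supN q by (auto simp: set_pmf_mixture P_def)
  have exc: "excess q P x (z1, z2) = L z1 z2 x / t z1 z2 - 1"
    if "x \<in> Zmod q" "z1 \<in> A" "z2 \<in> B" for x z1 z2
    using that mpos npos unfolding excess_def Pmix by (simp add: Px)
  have "chi2 q P = (\<Sum>(z1,z2)\<in>A\<times>B. pmf (mixture q P) (z1,z2)
      * ((\<Sum>x\<in>Zmod q. (excess q P x (z1,z2))\<^sup>2) / real q))"
    using fin sup by (subst chi2_sum[of "A \<times> B"]) (auto simp: split_def)
  also have "\<dots> \<le> (\<Sum>(z1,z2)\<in>A\<times>B. m z1 * n z2 *
      ((1 + \<delta>) * ((\<Sum>x\<in>Zmod q. (L z1 z2 x - 1)\<^sup>2) / real q) + K * (sqf z1 * sqg z2)))"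
  proof (rule sum_mono, clarify)
    fix z1 z2 assume z: "z1 \<in> A" "z2 \<in> B"
    have "t z1 z2 * ((\<Sum>x\<in>Zmod q. (L z1 z2 x / t z1 z2 - 1)\<^sup>2) / real q)
      \<le> (1 + \<delta>) * ((\<Sum>x\<in>Zmod q. (L z1 z2 x - 1)\<^sup>2) / real q) + K * (sqf z1 * sqg z2)"
      unfolding t_def L_def K_def sqf_def sqg_def
      using z by (intro merged_posterior_bound q \<delta>)
        (auto simp: f_def g_def A_def B_def excess_ge intro!: sum_excess q)
    then have "m z1 * n z2 * (t z1 z2 * ((\<Sum>x\<in>Zmod q. (L z1 z2 x / t z1 z2 - 1)\<^sup>2) / real q))
      \<le> m z1 * n z2 * ((1 + \<delta>) * ((\<Sum>x\<in>Zmod q. (L z1 z2 x - 1)\<^sup>2) / real q) + K * (sqf z1 * sqg z2))"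
      by (intro mult_left_mono) (auto simp: m0)
    then show "pmf (mixture q P) (z1,z2) * ((\<Sum>x\<in>Zmod q. (excess q P x (z1,z2))\<^sup>2) / real q)
      \<le> m z1 * n z2 * ((1 + \<delta>) * ((\<Sum>x\<in>Zmod q. (L z1 z2 x - 1)\<^sup>2) / real q) + K * (sqf z1 * sqg z2))"
      unfolding Pmix using z by (simp only: exc mult.assoc cong: sum.cong)
  qed
  also have "\<dots> = (1 + \<delta>) * ((\<Sum>x\<in>Zmod q. \<Sum>(z1,z2)\<in>A\<times>B. m z1 * n z2 * (L z1 z2 x - 1)\<^sup>2) / real q)
      + K * (\<Sum>(z1,z2)\<in>A\<times>B. (m z1 * sqf z1) * (n z2 * sqg z2))"
    by (subst sum.swap)
       (simp add: split_def sum_distrib_left sum_divide_distrib sum.distrib ring_distribs ac_simps)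
  also have "(\<Sum>(z1,z2)\<in>A\<times>B. (m z1 * sqf z1) * (n z2 * sqg z2)) = chi2 q M * chi2 q N"
    unfolding chi2_sum[OF fin(1), of q M, unfolded A_def, OF order_refl, folded A_def]
      chi2_sum[OF fin(2), of q N, unfolded B_def, OF order_refl, folded B_def]
    by (simp add: sum_product sum.cartesian_product m_def n_def sqf_def sqg_def f_def g_def)
  finally have step: "chi2 q P \<le> (1 + \<delta>) * ((\<Sum>x\<in>Zmod q. \<Sum>(z1,z2)\<in>A\<times>B. m z1 * n z2 * (L z1 z2 x - 1)\<^sup>2) / real q)
      + K * (chi2 q M * chi2 q N)" .
  have "(\<Sum>x\<in>Zmod q. \<Sum>(z1,z2)\<in>A\<times>B. m z1 * n z2 * (L z1 z2 x - 1)\<^sup>2) / real q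
     \<le> chi2 q M + chi2 q N + real q * (chi2 q M * chi2 q N)"
  proof -
    define a where "a = (\<lambda>x. \<Sum>z\<in>A. m z * (f x z)\<^sup>2)"
    define b where "b = (\<lambda>x. \<Sum>z\<in>B. n z * (g x z)\<^sup>2)"
    have a0: "0 \<le> a x" "0 \<le> b x" for x by (auto simp: a_def b_def m0 intro!: sum_nonneg)
    have aM: "(\<Sum>x\<in>Zmod q. a x) = real q * chi2 q M"
      using q unfolding chi2_sum[OF fin(1), of q M, unfolded A_def, OF order_refl, folded A_def] a_def
      by (subst sum.swap) (simp add: m_def f_def sum_distrib_left sum_divide_distrib)
    have bN: "(\<Sum>x\<in>Zmod q. b x) = real q * chi2 q N"
      using q unfolding chi2_sum[OF fin(2), of q N, unfolded B_def, OF order_refl, folded B_def] b_def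
      by (subst sum.swap) (simp add: n_def g_def sum_distrib_left sum_divide_distrib)
    have f1: "(\<Sum>z\<in>A. m z * (1 + f x z)) = 1" if "x \<in> Zmod q" for x
      using sum_pmf_eq_1[OF fin(1) supM[OF that]] by (simp add: Msum[OF that])
    have g1: "(\<Sum>z\<in>B. n z * (1 + g x z)) = 1" if "x \<in> Zmod q" for x
      using sum_pmf_eq_1[OF fin(2) supN[OF that]] by (simp add: Nsum[OF that])
    have eq: "(\<Sum>(z1,z2)\<in>A\<times>B. m z1 * n z2 * (L z1 z2 x - 1)\<^sup>2) = a x + b x + a x * b x"
      if x: "x \<in> Zmod q" for x
    proof -
      have f2: "(\<Sum>z\<in>A. m z * (1 + f x z)\<^sup>2) = 1 + a x"
      proof -
        have "(\<Sum>z\<in>A. m z * (1 + f x z)\<^sup>2)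
          = (\<Sum>z\<in>A. 2 * (m z * (1 + f x z)) - m z + m z * (f x z)\<^sup>2)"
          by (intro sum.cong refl) (simp add: power2_eq_square algebra_simps)
        also have "\<dots> = 2 * (\<Sum>z\<in>A. m z * (1 + f x z)) - (\<Sum>z\<in>A. m z) + a x"
          by (simp only: a_def sum.distrib sum_subtractf sum_distrib_left)
        finally show ?thesis using f1[OF x] m1(1) by simp
      qed
      have g2: "(\<Sum>z\<in>B. n z * (1 + g x z)\<^sup>2) = 1 + b x"
      proof -
        have "(\<Sum>z\<in>B. n z * (1 + g x z)\<^sup>2)
          = (\<Sum>z\<in>B. 2 * (n z * (1 + g x z)) - n z + n z * (g x z)\<^sup>2)"
          by (intro sum.cong refl) (simp add: power2_eq_square algebra_simps)
        also have "\<dots> = 2 * (\<Sum>z\<in>B. n z * (1 + g x z)) - (\<Sum>z\<in>B. n z) + b x"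
          by (simp only: b_def sum.distrib sum_subtractf sum_distrib_left)
        finally show ?thesis using g1[OF x] m1(2) by simp
      qed
      have "(\<Sum>(z1,z2)\<in>A\<times>B. m z1 * n z2 * (L z1 z2 x - 1)\<^sup>2)
        = (\<Sum>(z1,z2)\<in>A\<times>B. (m z1 * (1 + f x z1)\<^sup>2) * (n z2 * (1 + g x z2)\<^sup>2)
             - 2 * ((m z1 * (1 + f x z1)) * (n z2 * (1 + g x z2))) + m z1 * n z2)"
        by (intro sum.cong refl) (simp add: L_def split_def power2_eq_square, algebra)
      also have "\<dots> = (\<Sum>z\<in>A. m z * (1 + f x z)\<^sup>2) * (\<Sum>z\<in>B. n z * (1 + g x z)\<^sup>2)
         - 2 * ((\<Sum>z\<in>A. m z * (1 + f x z)) * (\<Sum>z\<in>B. n z * (1 + g x z)))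
         + (\<Sum>z\<in>A. m z) * (\<Sum>z\<in>B. n z)"
        by (simp only: sum_product sum.cartesian_product split_def sum.distrib sum_subtractf
            sum_distrib_left[of "2::real" _ "A \<times> B", symmetric])
      also have "\<dots> = a x + b x + a x * b x"
        unfolding f2 g2 f1[OF x] g1[OF x] m1 by (simp add: algebra_simps)
      finally show ?thesis .
    qed
    have "a x * b x \<le> (real q * chi2 q M) * b x" if "x \<in> Zmod q" for x
      unfolding aM[symmetric] using a0 that by (intro mult_right_mono member_le_sum) auto
    then have "(\<Sum>x\<in>Zmod q. a x * b x) \<le> (\<Sum>x\<in>Zmod q. (real q * chi2 q M) * b x)"
      by (rule sum_mono)
    also have "\<dots> = (real q * chi2 q M) * (real q * chi2 q N)"
      by (simp add: bN flip: sum_distrib_left)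
    finally have "(\<Sum>x\<in>Zmod q. a x + b x + a x * b x)
       \<le> real q * (chi2 q M + chi2 q N + real q * (chi2 q M * chi2 q N))"
      by (simp add: sum.distrib aM bN algebra_simps)
    moreover have "(\<Sum>x\<in>Zmod q. \<Sum>(z1,z2)\<in>A\<times>B. m z1 * n z2 * (L z1 z2 x - 1)\<^sup>2)
        = (\<Sum>x\<in>Zmod q. a x + b x + a x * b x)"
      by (intro sum.cong refl eq)
    ultimately show ?thesis using q by (simp add: divide_le_eq mult.commute)
  qed
  then have "(1 + \<delta>) * ((\<Sum>x\<in>Zmod q. \<Sum>(z1,z2)\<in>A\<times>B. m z1 * n z2 * (L z1 z2 x - 1)\<^sup>2) / real q)
     \<le> (1 + \<delta>) * (chi2 q M + chi2 q N + real q * (chi2 q M * chi2 q N))"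
    using \<delta> by (intro mult_left_mono) auto
  then have "chi2 q P \<le> (1 + \<delta>) * (chi2 q M + chi2 q N)
      + ((1 + \<delta>) * real q + K) * (chi2 q M * chi2 q N)"
    using step by (simp add: algebra_simps)
  then show ?thesis unfolding P_def K_def .
qed

text \<open>The divergence from the uniform law is largest for a point mass, where it equals \<open>q - 1\<close>.\<close>

lemma mean_sq_excess_le:
  assumes q: "0 < q" and z: "z \<in> set_pmf (mixture q M)"
  shows "(\<Sum>x\<in>Zmod q. (excess q M x z)\<^sup>2) / real q \<le> real q"
proof -
  let ?e = "\<lambda>x. excess q M x z"
  have s0: "(\<Sum>x\<in>Zmod q. ?e x) = 0" by (rule sum_excess[OF q z])
  have "1 + ?e x \<le> real q" if "x \<in> Zmod q" for x
  proof -
    have "0 \<le> 1 + ?e y" for y using excess_ge[of q M y z] by linarith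
    then have "1 + ?e x \<le> (\<Sum>x\<in>Zmod q. 1 + ?e x)"
      using that by (intro member_le_sum[where f = "\<lambda>x. 1 + ?e x"]) auto
    then show ?thesis by (simp add: sum.distrib s0)
  qed
  then have "(?e x)\<^sup>2 \<le> real q * (1 + ?e x) - 1 - 2 * ?e x" if "x \<in> Zmod q" for x
    using mult_right_mono[of "1 + ?e x" "real q" "1 + ?e x"] that excess_ge[of q M x z]
    by (simp add: power2_eq_square algebra_simps)
  then have "(\<Sum>x\<in>Zmod q. (?e x)\<^sup>2) \<le> (\<Sum>x\<in>Zmod q. real q * (1 + ?e x) - 1 - 2 * ?e x)"
    by (rule sum_mono)
  also have "\<dots> = real q * real q - real q"
    by (simp add: sum.distrib sum_subtractf s0 algebra_simps flip: sum_distrib_left)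
  also have "\<dots> \<le> real q * real q" by simp
  finally show ?thesis using q by (simp add: field_simps)
qed

lemma pmf_erasure_channel:
  assumes "0 \<le> \<epsilon>" "\<epsilon> \<le> 1"
  shows "pmf (erasure_channel \<epsilon> a) None = 1 - \<epsilon>"
    "pmf (erasure_channel \<epsilon> a) (Some y) = (if y = a then \<epsilon> else 0)"
  using assms unfolding erasure_channel_def by (auto simp: pmf_bind indicator_def)

text \<open>An erasure leaves the posterior unchanged. A revealed symbol, which has probability \<open>\<epsilon>\<close>, contributes
at most the largest possible divergence.\<close>

lemma chi2_reveal_le:
  assumes q: "0 < q" and \<epsilon>: "0 \<le> \<epsilon>" "\<epsilon> \<le> 1"
    and fM: "\<And>x. x \<in> Zmod q \<Longrightarrow> finite (set_pmf (M x))"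
  shows "chi2 q (\<lambda>x. pair_pmf (M x) (erasure_channel \<epsilon> x)) \<le> \<epsilon> * real q + chi2 q M"
proof -
  define A where "A = set_pmf (mixture q M)"
  define P where "P = (\<lambda>x. pair_pmf (M x) (erasure_channel \<epsilon> x))"
  let ?m = "pmf (mixture q M)"
  let ?s = "\<lambda>z. (\<Sum>x\<in>Zmod q. (excess q P x z)\<^sup>2) / real q"
  have fin: "finite A" unfolding A_def by (auto intro!: finite_mixture q fM)
  have supM: "set_pmf (M x) \<subseteq> A" if "x \<in> Zmod q" for x
    using that q by (auto simp: A_def set_pmf_mixture)
  have "set_pmf (erasure_channel \<epsilon> x) \<subseteq> insert None (Some ` Zmod q)" if "x \<in> Zmod q" for x
    using that by (auto simp: erasure_channel_def split: if_splits)
  then have sup: "set_pmf (mixture q P) \<subseteq> A \<times> insert None (Some ` Zmod q)"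
    unfolding set_pmf_mixture[OF q] P_def set_pair_pmf by (intro UN_least Sigma_mono supM)
  have PN: "pmf (mixture q P) (z, None) = (1 - \<epsilon>) * ?m z" for z
    using \<epsilon> by (simp add: pmf_mixture[OF q] P_def pmf_pair pmf_erasure_channel sum_distrib_left mult.commute)
  have PS: "pmf (mixture q P) (z, Some y) = \<epsilon> * pmf (M y) z / real q" if "y \<in> Zmod q" for z y
    using \<epsilon> that by (simp add: pmf_mixture[OF q] P_def pmf_pair pmf_erasure_channel if_distrib[of "\<lambda>a. _ * a"] sum.delta' cong: if_cong)
  have "chi2 q P = (\<Sum>z\<in>A. \<Sum>y\<in>insert None (Some ` Zmod q). pmf (mixture q P) (z,y) * ?s (z,y))"
    unfolding sum.cartesian_product using fin sup
    by (subst chi2_sum[of "A \<times> insert None (Some ` Zmod q)"]) (auto intro!: sum.cong)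
  also have "\<dots> = (\<Sum>z\<in>A. pmf (mixture q P) (z,None) * ?s (z,None))
      + (\<Sum>z\<in>A. \<Sum>y\<in>Zmod q. pmf (mixture q P) (z,Some y) * ?s (z,Some y))"
  proof -
    have "(\<Sum>y\<in>insert None (Some ` Zmod q). h y) = h None + (\<Sum>y\<in>Zmod q. h (Some y))"
      for h :: "int option \<Rightarrow> real"
      by (subst sum.insert) (auto simp: sum.reindex)
    then show ?thesis by (simp only: sum.distrib)
  qed
  also have "\<dots> \<le> chi2 q M + \<epsilon> * real q"
  proof (rule add_mono)
    have "(\<Sum>z\<in>A. pmf (mixture q P) (z,None) * ?s (z,None))
       = (1 - \<epsilon>) * (\<Sum>z\<in>A. ?m z * ((\<Sum>x\<in>Zmod q. (excess q M x z)\<^sup>2) / real q))"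
    proof (cases "\<epsilon> = 1")
      case False
      then have "excess q P x (z, None) = excess q M x z" for x z
        unfolding excess_def PN using \<epsilon> by (simp add: P_def pmf_pair pmf_erasure_channel)
      then show ?thesis by (simp add: PN sum_distrib_left mult.assoc)
    qed (simp add: PN)
    also have "\<dots> = (1 - \<epsilon>) * chi2 q M"
      by (subst chi2_sum[OF fin]) (auto simp: A_def)
    also have "\<dots> \<le> chi2 q M" using \<epsilon> chi2_nonneg[of q M] by (simp add: mult_left_le_one_le)
    finally show "(\<Sum>z\<in>A. pmf (mixture q P) (z,None) * ?s (z,None)) \<le> chi2 q M" .
    have "pmf (mixture q P) w * ?s w \<le> pmf (mixture q P) w * real q" for w
    proof (cases "w \<in> set_pmf (mixture q P)")
      case True
      then show ?thesis by (intro mult_left_mono mean_sq_excess_le q) auto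
    qed (simp add: set_pmf_eq)
    then have "(\<Sum>z\<in>A. \<Sum>y\<in>Zmod q. pmf (mixture q P) (z,Some y) * ?s (z,Some y))
       \<le> (\<Sum>z\<in>A. \<Sum>y\<in>Zmod q. pmf (mixture q P) (z,Some y) * real q)"
      by (intro sum_mono)
    also have "\<dots> = (\<Sum>y\<in>Zmod q. \<Sum>z\<in>A. \<epsilon> * pmf (M y) z)"
      using q by (subst sum.swap) (simp add: PS)
    also have "\<dots> = (\<Sum>y\<in>Zmod q. \<epsilon>)"
      by (intro sum.cong refl) (simp add: sum_pmf_eq_1[OF fin supM] flip: sum_distrib_left)
    also have "\<dots> = \<epsilon> * real q" by simp
    finally show "(\<Sum>z\<in>A. \<Sum>y\<in>Zmod q. pmf (mixture q P) (z,Some y) * ?s (z,Some y)) \<le> \<epsilon> * real q" .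
  qed
  finally show ?thesis by (simp add: P_def)
qed

definition noisy_channel :: "nat \<Rightarrow> real \<Rightarrow> int \<Rightarrow> int pmf" where
  "noisy_channel q p w =
    do { noisy \<leftarrow> bernoulli_pmf p; if noisy then pmf_of_set (Zmod q) else return_pmf w }"

text \<open>For a fixed edge value \<open>w\<close>, the hypothesis on \<open>\<pi>\<close> says that in the absence of noise the far label is a
bijective function \<open>\<pi> w x\<close> of \<open>x\<close>. The noise mixes the corresponding likelihood ratio with the constant
one, so the excess at \<open>x\<close> is \<open>1 - p\<close> times the excess at \<open>\<pi> w x\<close>.\<close>

lemma chi2_noisy_edge:
  assumes q: "0 < q" and p: "0 \<le> p" "p \<le> 1"
    and fM: "\<And>x. x \<in> Zmod q \<Longrightarrow> finite (set_pmf (M x))"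
    and W: "\<And>x y. x \<in> Zmod q \<Longrightarrow> y \<in> Zmod q \<Longrightarrow> W x y \<in> Zmod q"
    and \<pi>: "\<And>w. w \<in> Zmod q \<Longrightarrow> bij_betw (\<pi> w) (Zmod q) (Zmod q)"
    and W\<pi>: "\<And>w x y. w \<in> Zmod q \<Longrightarrow> x \<in> Zmod q \<Longrightarrow> y \<in> Zmod q \<Longrightarrow> W x y = w \<longleftrightarrow> y = \<pi> w x"
  shows "chi2 q (\<lambda>x. do { y \<leftarrow> pmf_of_set (Zmod q); pair_pmf (noisy_channel q p (W x y)) (M y) })
    = (1 - p)\<^sup>2 * chi2 q M"
proof -
  define A where "A = set_pmf (mixture q M)"
  define P where "P = (\<lambda>x. do { y \<leftarrow> pmf_of_set (Zmod q); pair_pmf (noisy_channel q p (W x y)) (M y) })"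
  let ?m = "pmf (mixture q M)"
  have fin: "finite A" unfolding A_def by (auto intro!: finite_mixture q fM)
  have supM: "set_pmf (M x) \<subseteq> A" if "x \<in> Zmod q" for x
    using that q by (auto simp: A_def set_pmf_mixture)
  have pn: "pmf (noisy_channel q p v) w = p / real q + (1 - p) * (if v = w then 1 else 0)"
    if "w \<in> Zmod q" for v w
    using p that q by (simp add: noisy_channel_def pmf_bind indicator_def)
  have sn: "set_pmf (noisy_channel q p v) \<subseteq> Zmod q" if "v \<in> Zmod q" for v
    using that q by (auto simp: noisy_channel_def set_pmf_Zmod split: if_splits)
  have \<pi>in: "\<pi> w x \<in> Zmod q" if "w \<in> Zmod q" "x \<in> Zmod q" for w x
    using \<pi>[OF that(1)] that(2) by (auto simp: bij_betw_def)
  have sup: "set_pmf (mixture q P) \<subseteq> Zmod q \<times> A"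
    unfolding set_pmf_mixture[OF q] P_def set_bind_pmf set_pair_pmf set_pmf_Zmod[OF q]
    by (intro UN_least Sigma_mono supM sn W)
  have Px: "pmf (P x) (w, z) = (p * ?m z + (1 - p) * pmf (M (\<pi> w x)) z) / real q"
    if x: "x \<in> Zmod q" and w: "w \<in> Zmod q" for x w z
  proof -
    have "pmf (P x) (w, z) = (\<Sum>y\<in>Zmod q. pmf (noisy_channel q p (W x y)) w * pmf (M y) z) / real q"
      using q unfolding P_def by (subst pmf_bind_pmf_of_set) (auto simp: pmf_pair)
    also have "(\<Sum>y\<in>Zmod q. pmf (noisy_channel q p (W x y)) w * pmf (M y) z)
      = (\<Sum>y\<in>Zmod q. p / real q * pmf (M y) z + (if y = \<pi> w x then (1 - p) * pmf (M y) z else 0))"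
      by (intro sum.cong refl) (simp add: pn[OF w] W\<pi>[OF w x] algebra_simps)
    also have "\<dots> = p * ?m z + (1 - p) * pmf (M (\<pi> w x)) z"
      using \<pi>in[OF w x] by (simp add: sum.distrib pmf_mixture[OF q] sum_distrib_left sum_divide_distrib)
    finally show ?thesis .
  qed
  have Pmix: "pmf (mixture q P) (w, z) = ?m z / real q" if w: "w \<in> Zmod q" for w z
  proof -
    have "(\<Sum>x\<in>Zmod q. pmf (M (\<pi> w x)) z) = (\<Sum>x\<in>Zmod q. pmf (M x) z)"
      by (rule sum.reindex_bij_betw[OF \<pi>[OF w]])
    also have "\<dots> = real q * ?m z" using q by (simp add: pmf_mixture)
    finally have "(\<Sum>x\<in>Zmod q. pmf (P x) (w, z)) = ?m z"
      using q by (simp add: Px[OF _ w] sum.distrib flip: sum_divide_distrib sum_distrib_left) (simp add: field_simps)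
    then show ?thesis by (simp add: pmf_mixture[OF q, of P])
  qed
  have exc: "excess q P x (w, z) = (1 - p) * excess q M (\<pi> w x) z"
    if "x \<in> Zmod q" "w \<in> Zmod q" "z \<in> A" for x w z
  proof -
    have "?m z \<noteq> 0" using that by (simp add: A_def set_pmf_eq)
    then show ?thesis using q unfolding excess_def Pmix[OF that(2)] Px[OF that(1,2)]
      by (simp add: field_simps)
  qed
  have "chi2 q P = (\<Sum>(w,z)\<in>Zmod q \<times> A. pmf (mixture q P) (w,z) * ((\<Sum>x\<in>Zmod q. (excess q P x (w,z))\<^sup>2) / real q))"
    using fin sup by (subst chi2_sum[of "Zmod q \<times> A"]) (auto simp: split_def)
  also have "\<dots> = (\<Sum>(w,z)\<in>Zmod q \<times> A. (1 - p)\<^sup>2 / real q * (?m z * ((\<Sum>x\<in>Zmod q. (excess q M x z)\<^sup>2) / real q)))"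
  proof (intro sum.cong refl, clarify)
    fix w z assume wz: "w \<in> Zmod q" "z \<in> A"
    have "(\<Sum>x\<in>Zmod q. (excess q P x (w,z))\<^sup>2) = (1 - p)\<^sup>2 * (\<Sum>x\<in>Zmod q. (excess q M (\<pi> w x) z)\<^sup>2)"
      using wz by (simp add: exc power_mult_distrib sum_distrib_left)
    also have "(\<Sum>x\<in>Zmod q. (excess q M (\<pi> w x) z)\<^sup>2) = (\<Sum>x\<in>Zmod q. (excess q M x z)\<^sup>2)"
      by (rule sum.reindex_bij_betw[OF \<pi>[OF wz(1)], where g = "\<lambda>x. (excess q M x z)\<^sup>2"])
    finally show "pmf (mixture q P) (w,z) * ((\<Sum>x\<in>Zmod q. (excess q P x (w,z))\<^sup>2) / real q)
      = (1 - p)\<^sup>2 / real q * (?m z * ((\<Sum>x\<in>Zmod q. (excess q M x z)\<^sup>2) / real q))"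
      by (simp add: Pmix[OF wz(1)])
  qed
  also have "\<dots> = (\<Sum>w\<in>Zmod q. (1 - p)\<^sup>2 / real q * chi2 q M)"
    by (subst chi2_sum[OF fin]) (auto simp: A_def sum_distrib_left simp flip: sum.cartesian_product)
  also have "\<dots> = (1 - p)\<^sup>2 * chi2 q M" using q by simp
  finally show ?thesis by (simp add: P_def)
qed

lemma d_TV_sq_le:
  assumes q: "0 < q"
  shows "(d_TV (Zmod q) (\<lambda>x. (1 + e x) / real q) (\<lambda>x. 1 / real q))\<^sup>2 \<le> (\<Sum>x\<in>Zmod q. (e x)\<^sup>2) / real q"
proof -
  have "(\<Sum>x\<in>Zmod q. 1 * \<bar>e x\<bar>)\<^sup>2 \<le> (\<Sum>x\<in>Zmod q. 1\<^sup>2) * (\<Sum>x\<in>Zmod q. \<bar>e x\<bar>\<^sup>2)"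
    by (rule Cauchy_Schwarz_ineq_sum)
  then have c: "(\<Sum>x\<in>Zmod q. \<bar>e x\<bar>)\<^sup>2 \<le> real q * (\<Sum>x\<in>Zmod q. (e x)\<^sup>2)" by simp
  have "d_TV (Zmod q) (\<lambda>x. (1 + e x) / real q) (\<lambda>x. 1 / real q) = (\<Sum>x\<in>Zmod q. \<bar>e x\<bar>) / real q / 2"
    unfolding d_TV_def by (simp add: add_divide_distrib sum_divide_distrib)
  also have "\<dots>\<^sup>2 = (\<Sum>x\<in>Zmod q. \<bar>e x\<bar>)\<^sup>2 / (4 * (real q)\<^sup>2)"
    by (simp add: power_divide power_mult_distrib)
  also have "\<dots> \<le> real q * (\<Sum>x\<in>Zmod q. (e x)\<^sup>2) / (4 * (real q)\<^sup>2)"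
    by (intro divide_right_mono c) auto
  also have "\<dots> = (\<Sum>x\<in>Zmod q. (e x)\<^sup>2) / real q / 4"
    using q by (simp add: power2_eq_square)
  also have "\<dots> \<le> (\<Sum>x\<in>Zmod q. (e x)\<^sup>2) / real q"
  proof -
    have "0 \<le> (\<Sum>x\<in>Zmod q. (e x)\<^sup>2) / real q" by (simp add: sum_nonneg)
    moreover have "s / 4 \<le> s" if "0 \<le> s" for s :: real using that by simp
    ultimately show ?thesis by blast
  qed
  finally show ?thesis .
qed

section \<open>Observations on a subgraph\<close>

lemma edge_channel_noisy: "edge_channel q p a b = noisy_channel q p ((a - b) mod int q)"
  by (simp add: edge_channel_def noisy_channel_def)

lemma finite_set_Pi_pmf:
  "finite A \<Longrightarrow> (\<And>x. x \<in> A \<Longrightarrow> finite (set_pmf (p x))) \<Longrightarrow> finite (set_pmf (Pi_pmf A d p))"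
  by (auto simp: set_Pi_pmf)

lemma finite_set_edge_channel: "0 < q \<Longrightarrow> finite (set_pmf (edge_channel q p a b))"
  by (auto simp: edge_channel_def set_pmf_Zmod)

lemma finite_set_erasure_channel: "finite (set_pmf (erasure_channel \<epsilon> a))"
  by (simp add: erasure_channel_def)

type_synonym obs = "(nat \<times> nat \<Rightarrow> int) \<times> (nat \<Rightarrow> int option)"

definition obs_given :: "nat \<Rightarrow> real \<Rightarrow> real \<Rightarrow> nat set \<Rightarrow> nat rel \<Rightarrow> (nat \<Rightarrow> int) \<Rightarrow> obs pmf" where
  "obs_given q p \<epsilon> R F \<theta> = pair_pmf (Pi_pmf F 0 (\<lambda>(u, v). edge_channel q p (\<theta> u) (\<theta> v)))
     (Pi_pmf R None (\<lambda>u. erasure_channel \<epsilon> (\<theta> u)))"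

text \<open>The law of the edge values on \<open>F\<close> and the side information on \<open>R\<close>, when the root \<open>r\<close> has label \<open>x\<close> and
the other vertices of \<open>S\<close> have independent uniform labels. The set \<open>R\<close> is kept apart from \<open>S\<close> because
the side information at the root is added only after the subtrees of its children have been merged.\<close>

definition obs_law ::
    "nat \<Rightarrow> real \<Rightarrow> real \<Rightarrow> nat set \<Rightarrow> nat set \<Rightarrow> nat rel \<Rightarrow> nat \<Rightarrow> int \<Rightarrow> obs pmf" where
  "obs_law q p \<epsilon> S R F r x = do {
     \<theta> \<leftarrow> Pi_pmf (S - {r}) 0 (\<lambda>_. pmf_of_set (Zmod q));
     obs_given q p \<epsilon> R F (\<theta>(r := x)) }"

lemma finite_set_obs_given:
  "0 < q \<Longrightarrow> finite R \<Longrightarrow> finite F \<Longrightarrow> finite (set_pmf (obs_given q p \<epsilon> R F \<theta>))"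
  unfolding obs_given_def
  by (auto intro!: finite_set_Pi_pmf finite_set_edge_channel finite_set_erasure_channel)

lemma finite_set_obs_law:
  "0 < q \<Longrightarrow> finite S \<Longrightarrow> finite R \<Longrightarrow> finite F \<Longrightarrow> finite (set_pmf (obs_law q p \<epsilon> S R F r x))"
  unfolding obs_law_def
  by (auto intro!: finite_set_Pi_pmf finite_set_obs_given simp: set_pmf_Zmod)

lemma obs_given_cong:
  assumes "\<And>v. v \<in> S \<Longrightarrow> \<theta> v = \<theta>' v" "R \<subseteq> S" "F \<subseteq> S \<times> S"
  shows "obs_given q p \<epsilon> R F \<theta> = obs_given q p \<epsilon> R F \<theta>'"
  unfolding obs_given_def using assms by (intro arg_cong2[where f = pair_pmf] Pi_pmf_cong) auto

definition union_obs :: "nat set \<Rightarrow> nat rel \<Rightarrow> obs \<times> obs \<Rightarrow> obs" where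
  "union_obs R F = (\<lambda>((Y, \<xi>), (Y', \<xi>')).
     (\<lambda>e. if e \<in> F then Y e else Y' e, \<lambda>v. if v \<in> R then \<xi> v else \<xi>' v))"

lemma obs_given_union:
  assumes "finite R" "finite R'" "R \<inter> R' = {}" "finite F" "finite F'" "F \<inter> F' = {}"
  shows "obs_given q p \<epsilon> (R \<union> R') (F \<union> F') \<theta> =
    map_pmf (union_obs R F) (pair_pmf (obs_given q p \<epsilon> R F \<theta>) (obs_given q p \<epsilon> R' F' \<theta>))"
proof -
  have shuffle: "pair_pmf (map_pmf f (pair_pmf A B)) (map_pmf g (pair_pmf C D)) =
      map_pmf (\<lambda>((a, c), (b, d)). (f (a, b), g (c, d))) (pair_pmf (pair_pmf A C) (pair_pmf B D))"
    for f :: "'a \<times> 'b \<Rightarrow> 'e" and g :: "'c \<times> 'd \<Rightarrow> 'h" and A B C D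
    unfolding pair_pmf_def map_pmf_def
    by (simp add: bind_assoc_pmf bind_return_pmf bind_commute_pmf[of B C])
  show ?thesis
    unfolding obs_given_def Pi_pmf_union[OF assms(1-3)] Pi_pmf_union[OF assms(4-6)] shuffle union_obs_def
    by (intro map_pmf_cong refl) auto
qed

text \<open>Given the label of the cut vertex \<open>r\<close>, the observations on the two sides are independent.\<close>

lemma obs_law_glue:
  assumes fin: "finite S" "finite S'" and S: "S \<inter> S' = {r}"
    and R: "R \<subseteq> S" "R' \<subseteq> S'" "R \<inter> R' = {}"
    and F: "F \<subseteq> S \<times> S" "F' \<subseteq> S' \<times> S'" "F \<inter> F' = {}"
  shows "obs_law q p \<epsilon> (S \<union> S') (R \<union> R') (F \<union> F') r x =
    map_pmf (union_obs R F) (pair_pmf (obs_law q p \<epsilon> S R F r x) (obs_law q p \<epsilon> S' R' F' r x))"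
proof -
  let ?P = "\<lambda>A. Pi_pmf A 0 (\<lambda>_::nat. pmf_of_set (Zmod q))"
  let ?G = "\<lambda>R F \<theta>. obs_given q p \<epsilon> R F (\<theta>(r := x))"
  have finRF: "finite R" "finite R'" "finite F" "finite F'"
    using fin R F by (auto intro: finite_subset)
  have pair_bind: "pair_pmf (bind_pmf A f) (bind_pmf B g)
      = bind_pmf (pair_pmf A B) (\<lambda>(a, b). pair_pmf (f a) (g b))"
    for A :: "'a pmf" and B :: "'b pmf" and f :: "'a \<Rightarrow> 'c pmf" and g :: "'b \<Rightarrow> 'd pmf"
    unfolding pair_pmf_def
    by (simp add: bind_assoc_pmf bind_return_pmf) (simp only: bind_commute_pmf[of _ B])
  have split: "S \<union> S' - {r} = (S - {r}) \<union> (S' - {r})" "(S - {r}) \<inter> (S' - {r}) = {}"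
    using S by auto
  have "obs_law q p \<epsilon> (S \<union> S') (R \<union> R') (F \<union> F') r x =
     bind_pmf (pair_pmf (?P (S - {r})) (?P (S' - {r})))
       (\<lambda>(\<theta>, \<theta>'). ?G (R \<union> R') (F \<union> F') (\<lambda>v. if v \<in> S - {r} then \<theta> v else \<theta>' v))"
    unfolding obs_law_def split(1) using fin
    by (subst Pi_pmf_union[OF _ _ split(2)]) (auto simp: bind_map_pmf split_def)
  also have "\<dots> = bind_pmf (pair_pmf (?P (S - {r})) (?P (S' - {r})))
       (\<lambda>(\<theta>, \<theta>'). map_pmf (union_obs R F) (pair_pmf (?G R F \<theta>) (?G R' F' \<theta>')))"
  proof (intro bind_pmf_cong refl, clarify)
    fix \<theta> \<theta>' :: "nat \<Rightarrow> int"
    let ?\<eta> = "\<lambda>v. if v \<in> S - {r} then \<theta> v else \<theta>' v"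
    have "?G R F ?\<eta> = ?G R F \<theta>"
      by (rule obs_given_cong[of S]) (use R F in auto)
    moreover have "?G R' F' ?\<eta> = ?G R' F' \<theta>'"
      by (rule obs_given_cong[of S']) (use R F S in auto)
    ultimately show "?G (R \<union> R') (F \<union> F') ?\<eta> =
        map_pmf (union_obs R F) (pair_pmf (?G R F \<theta>) (?G R' F' \<theta>'))"
      using obs_given_union[OF finRF(1,2) R(3) finRF(3,4) F(3)] by simp
  qed
  also have "\<dots> = map_pmf (union_obs R F) (pair_pmf (obs_law q p \<epsilon> S R F r x) (obs_law q p \<epsilon> S' R' F' r x))"
    by (simp add: obs_law_def pair_bind map_bind_pmf split_def)
  finally show ?thesis .
qed

text \<open>A new root \<open>r\<close> is attached to the old root \<open>c\<close> by an edge in either direction: the label of \<open>c\<close> becomes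
uniform, and the new edge carries a noisy version of the difference of the two labels.\<close>

lemma obs_law_extend:
  assumes fin: "finite S" and r: "r \<notin> S" and c: "c \<in> S" and F: "F \<subseteq> S \<times> S"
    and e: "e = (r, c) \<and> W = (\<lambda>x y. (x - y) mod int q) \<or> e = (c, r) \<and> W = (\<lambda>x y. (y - x) mod int q)"
  shows "obs_law q p \<epsilon> (insert r S) S (insert e F) r x =
    map_pmf (\<lambda>(w, Y, \<xi>). (Y(e := w), \<xi>))
      (do { y \<leftarrow> pmf_of_set (Zmod q); pair_pmf (noisy_channel q p (W x y)) (obs_law q p \<epsilon> S S F c y) })"
proof -
  let ?P = "\<lambda>A. Pi_pmf A 0 (\<lambda>_::nat. pmf_of_set (Zmod q))"
  let ?h = "\<lambda>(w, Y, \<xi>). (Y(e := w), \<xi>) :: obs"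
  have finF: "finite F" using fin F by (auto intro: finite_subset)
  have eF: "e \<notin> F" using e F r by auto
  have Sr: "insert r S - {r} = insert c (S - {c})" using r c by auto
  have given: "obs_given q p \<epsilon> S (insert e F) (\<theta>(c := y, r := x)) =
      map_pmf ?h (pair_pmf (noisy_channel q p (W x y)) (obs_given q p \<epsilon> S F (\<theta>(c := y))))" for \<theta> y
  proof -
    have ech: "(case e of (u, v) \<Rightarrow> edge_channel q p ((\<theta>(c := y, r := x)) u) ((\<theta>(c := y, r := x)) v))
       = noisy_channel q p (W x y)"
      using e r c by (auto simp: edge_channel_noisy)
    have "obs_given q p \<epsilon> S F (\<theta>(c := y)) = obs_given q p \<epsilon> S F (\<theta>(c := y, r := x))"
      by (rule obs_given_cong[of S]) (use r F in auto)
    then show ?thesis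
      unfolding obs_given_def Pi_pmf_insert[OF finF eF] ech
      by (simp add: pair_pmf_def map_pmf_def bind_assoc_pmf bind_return_pmf)
  qed
  have "obs_law q p \<epsilon> (insert r S) S (insert e F) r x =
     bind_pmf (pmf_of_set (Zmod q)) (\<lambda>y. bind_pmf (?P (S - {c}))
       (\<lambda>\<theta>. obs_given q p \<epsilon> S (insert e F) (\<theta>(c := y, r := x))))"
    unfolding obs_law_def Sr using fin
    by (subst Pi_pmf_insert') (auto simp: bind_assoc_pmf bind_return_pmf)
  also have "\<dots> = map_pmf ?h (do { y \<leftarrow> pmf_of_set (Zmod q);
      pair_pmf (noisy_channel q p (W x y)) (obs_law q p \<epsilon> S S F c y) })"
    unfolding given obs_law_def map_bind_pmf
    by (intro bind_pmf_cong refl)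
       (simp add: pair_pmf_def map_pmf_def bind_assoc_pmf bind_return_pmf bind_commute_pmf[of "noisy_channel q p _"])
  finally show ?thesis .
qed

lemma chi2_extend_le:
  assumes q: "0 < q" and p: "0 \<le> p" "p \<le> 1"
    and S: "finite S" "r \<notin> S" "c \<in> S" "F \<subseteq> S \<times> S" and e: "e = (r, c) \<or> e = (c, r)"
  shows "chi2 q (obs_law q p \<epsilon> (insert r S) S (insert e F) r)
    \<le> (1 - p)\<^sup>2 * chi2 q (obs_law q p \<epsilon> S S F c)"
proof -
  \<comment> \<open>The sign \<open>s\<close> treats both directions of the edge at once.\<close>
  define s :: int where "s = (if e = (r, c) then 1 else - 1)"
  define W where "W = (\<lambda>x y. (s * (x - y)) mod int q)"
  define \<pi> where "\<pi> = (\<lambda>w x. (x - s * w) mod int q)"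
  define Q where "Q = (\<lambda>x. do { y \<leftarrow> pmf_of_set (Zmod q);
      pair_pmf (noisy_channel q p (W x y)) (obs_law q p \<epsilon> S S F c y) })"
  have s: "s * s = 1" "s = 1 \<or> s = - 1" by (auto simp: s_def)
  have finF: "finite F" using S by (auto intro: finite_subset)
  have fin: "finite (set_pmf (obs_law q p \<epsilon> S S F c y))" for y
    using S q finF by (intro finite_set_obs_law) auto
  have modin: "a mod int q \<in> Zmod q" for a using q by (simp add: Zmod_def)
  have modid: "a mod int q = a" if "a \<in> Zmod q" for a using that by (simp add: Zmod_def)
  have W\<pi>: "W x y = w \<longleftrightarrow> y = \<pi> w x"
    if "w \<in> Zmod q" "x \<in> Zmod q" "y \<in> Zmod q" for w x y
  proof -
    have "W x y = w \<longleftrightarrow> int q dvd s * (x - y) - w"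
      using modid[OF that(1)] unfolding W_def by (metis mod_eq_dvd_iff)
    also have "\<dots> \<longleftrightarrow> int q dvd y - (x - s * w)"
      using s(2) by (auto simp: algebra_simps dvd_diff_commute)
    also have "\<dots> \<longleftrightarrow> y = \<pi> w x"
      using modid[OF that(3)] unfolding \<pi>_def by (metis mod_eq_dvd_iff)
    finally show ?thesis .
  qed
  have "(w :: int) \<in> Zmod q \<Longrightarrow> bij_betw (\<pi> w) (Zmod q) (Zmod q)" for w
  proof (rule bij_betw_byWitness[where f' = "\<lambda>y. (y + s * w) mod int q"])
    show "\<forall>a\<in>Zmod q. (\<pi> w a + s * w) mod int q = a"
      using modid by (simp add: \<pi>_def mod_simps)
    show "\<forall>a\<in>Zmod q. \<pi> w ((a + s * w) mod int q) = a"
      using modid by (simp add: \<pi>_def mod_simps)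
  qed (auto simp: \<pi>_def modin)
  then have "chi2 q Q = (1 - p)\<^sup>2 * chi2 q (obs_law q p \<epsilon> S S F c)"
    unfolding Q_def using W\<pi> by (intro chi2_noisy_edge q p fin) (auto simp: W_def modin)
  moreover have "chi2 q (obs_law q p \<epsilon> (insert r S) S (insert e F) r) \<le> chi2 q Q"
  proof -
    have We: "e = (r, c) \<and> W = (\<lambda>x y. (x - y) mod int q) \<or> e = (c, r) \<and> W = (\<lambda>x y. (y - x) mod int q)"
      using e by (auto simp: W_def s_def)
    have "obs_law q p \<epsilon> (insert r S) S (insert e F) r = (\<lambda>x. map_pmf (\<lambda>(w, Y, \<xi>). (Y(e := w), \<xi>)) (Q x))"
      unfolding Q_def using obs_law_extend[OF S We] by blast
    moreover have "finite (set_pmf (Q x))" for x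
      unfolding Q_def using q fin
      by (auto simp: set_pmf_Zmod noisy_channel_def intro!: finite_cartesian_product)
    ultimately show ?thesis using chi2_map_le[OF q, of Q] by simp
  qed
  ultimately show ?thesis by simp
qed

lemma chi2_reveal_root_le:
  assumes q: "0 < q" and \<epsilon>: "0 \<le> \<epsilon>" "\<epsilon> \<le> 1" and S: "finite S" "r \<in> S" "F \<subseteq> S \<times> S"
  shows "chi2 q (obs_law q p \<epsilon> S S F r) \<le> \<epsilon> * real q + chi2 q (obs_law q p \<epsilon> S (S - {r}) F r)"
proof -
  let ?M = "obs_law q p \<epsilon> S (S - {r}) F r"
  define h where "h = (\<lambda>a. (\<lambda>_. 0, (\<lambda>v. if v = r then a else None)) :: obs)"
  have finF: "finite F" using S by (auto intro: finite_subset)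
  have fin: "finite (set_pmf (?M x))" for x
    using S q finF by (intro finite_set_obs_law) auto
  have single: "obs_law q p \<epsilon> {r} {r} {} r x = map_pmf h (erasure_channel \<epsilon> x)" for x
    by (simp add: obs_law_def obs_given_def h_def bind_return_pmf Pi_pmf_singleton pair_return_pmf1 pmf.map_comp o_def)
  have "obs_law q p \<epsilon> (S \<union> {r}) ((S - {r}) \<union> {r}) (F \<union> {}) r x
    = map_pmf (union_obs (S - {r}) F) (pair_pmf (?M x) (obs_law q p \<epsilon> {r} {r} {} r x))" for x
    using S by (intro obs_law_glue) auto
  moreover have "S \<union> {r} = S" "(S - {r}) \<union> {r} = S" using S by auto
  ultimately have "obs_law q p \<epsilon> S S F r
    = (\<lambda>x. map_pmf (union_obs (S - {r}) F \<circ> apsnd h) (pair_pmf (?M x) (erasure_channel \<epsilon> x)))"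
    by (simp add: single pair_map_pmf2 pmf.map_comp fun_eq_iff)
  then have "chi2 q (obs_law q p \<epsilon> S S F r) \<le> chi2 q (\<lambda>x. pair_pmf (?M x) (erasure_channel \<epsilon> x))"
    using chi2_map_le[OF q, of "\<lambda>x. pair_pmf (?M x) (erasure_channel \<epsilon> x)"] fin finite_set_erasure_channel
    by simp
  also have "\<dots> \<le> \<epsilon> * real q + chi2 q ?M"
    by (rule chi2_reveal_le[OF q \<epsilon> fin])
  finally show ?thesis .
qed

definition restrict_obs :: "nat set \<Rightarrow> nat rel \<Rightarrow> obs \<Rightarrow> obs" where
  "restrict_obs R F = (\<lambda>(Y, \<xi>). (restrict Y F, restrict \<xi> R))"

lemma map_restrict_obs_given:
  assumes "finite R'" "finite F'" "R \<subseteq> R'" "F \<subseteq> F'"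
  shows "map_pmf (restrict_obs R F) (obs_given q p \<epsilon> R' F' \<theta>) = map_pmf (restrict_obs R F) (obs_given q p \<epsilon> R F \<theta>)"
proof -
  have r: "map_pmf (\<lambda>f. restrict f B) (Pi_pmf A d P) = map_pmf (\<lambda>f. restrict f B) (Pi_pmf B d P)"
    if "finite A" "B \<subseteq> A" for A B :: "'a set" and d :: 'b and P
    using that by (simp add: Pi_pmf_subset[of A B] pmf.map_comp o_def restrict_def cong: if_cong)
  show ?thesis unfolding obs_given_def restrict_obs_def map_pair
    using assms by (simp add: r[of R' R] r[of F' F])
qed

text \<open>Labels, edge values and side information outside the ball are independent of everything inside once the
labels in the ball are given, and can be discarded.\<close>

lemma sync_local_law:
  assumes D: "finite D" and B: "graph_ball E u l \<subseteq> {..<n}" "u \<in> graph_ball E u l"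
  defines "S \<equiv> graph_ball E u l" and "F \<equiv> D \<inter> graph_ball E u l \<times> graph_ball E u l"
  shows "map_pmf (\<lambda>\<omega>. (labels \<omega> u, local_obs E D u l \<omega>)) (sync_pmf q p \<epsilon> n D) =
    do { x \<leftarrow> pmf_of_set (Zmod q); z \<leftarrow> map_pmf (restrict_obs S F) (obs_law q p \<epsilon> S S F u x); return_pmf (x, z) }"
proof -
  let ?P = "\<lambda>A. Pi_pmf A 0 (\<lambda>_::nat. pmf_of_set (Zmod q))"
  have u: "u \<in> S" and Sn: "S \<subseteq> {..<n}" using B by (auto simp: S_def)
  have finS: "finite S" using Sn by (rule finite_subset) simp
  have "map_pmf (\<lambda>\<omega>. (labels \<omega> u, local_obs E D u l \<omega>)) (sync_pmf q p \<epsilon> n D)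
    = bind_pmf (?P {..<n}) (\<lambda>\<theta>. map_pmf (Pair (\<theta> u)) (map_pmf (restrict_obs S F) (obs_given q p \<epsilon> {..<n} D \<theta>)))"
    by (simp add: sync_pmf_def obs_given_def map_pmf_def pair_pmf_def bind_assoc_pmf bind_return_pmf
        labels_def local_obs_def restrict_obs_def S_def F_def)
  also have "\<dots> = bind_pmf (?P {..<n}) (\<lambda>\<theta>. map_pmf (Pair (\<theta> u)) (map_pmf (restrict_obs S F) (obs_given q p \<epsilon> S F \<theta>)))"
    using D Sn by (subst map_restrict_obs_given[of "{..<n}" D S F]) (auto simp: F_def)
  also have "\<dots> = bind_pmf (map_pmf (\<lambda>\<theta> v. if v \<in> S then \<theta> v else 0) (?P {..<n}))
      (\<lambda>\<theta>. map_pmf (Pair (\<theta> u)) (map_pmf (restrict_obs S F) (obs_given q p \<epsilon> S F \<theta>)))"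
    unfolding bind_map_pmf
    by (intro bind_pmf_cong refl arg_cong2[where f = map_pmf] obs_given_cong[of S])
       (use u in \<open>auto simp: F_def S_def\<close>)
  also have "\<dots> = bind_pmf (?P (insert u (S - {u})))
      (\<lambda>\<theta>. map_pmf (Pair (\<theta> u)) (map_pmf (restrict_obs S F) (obs_given q p \<epsilon> S F \<theta>)))"
    using Sn u by (subst Pi_pmf_subset[of "{..<n}" S, symmetric]) (auto simp: insert_absorb)
  also have "\<dots> = do { x \<leftarrow> pmf_of_set (Zmod q); z \<leftarrow> map_pmf (restrict_obs S F) (obs_law q p \<epsilon> S S F u x); return_pmf (x, z) }"
    using finS by (subst Pi_pmf_insert')
      (auto simp: obs_law_def map_pmf_def bind_assoc_pmf bind_return_pmf)
  finally show ?thesis .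
qed

text \<open>The posterior at an observed value \<open>z\<close> is \<open>(1 + excess q M x z) / q\<close>, so Cauchy-Schwarz bounds the squared
distance at \<open>z\<close> by the mean square of the excess.\<close>

lemma expected_sq_TV_le_chi2:
  assumes q: "0 < q" and fin: "\<And>x. x \<in> Zmod q \<Longrightarrow> finite (set_pmf (M x))"
    and law: "map_pmf (\<lambda>\<omega>. (X \<omega>, Z \<omega>)) P = do { x \<leftarrow> pmf_of_set (Zmod q); z \<leftarrow> M x; return_pmf (x, z) }"
  shows "measure_pmf.expectation P (\<lambda>\<omega>. (d_TV (Zmod q)
      (\<lambda>x. \<P>(\<omega>' in measure_pmf P. X \<omega>' = x \<bar> Z \<omega>' = Z \<omega>)) (pmf (pmf_of_set (Zmod q))))\<^sup>2) \<le> chi2 q M"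
proof -
  let ?m = "mixture q M"
  let ?post = "\<lambda>z x. \<P>(\<omega>' in measure_pmf P. X \<omega>' = x \<bar> Z \<omega>' = z)"
  have Zlaw: "map_pmf Z P = ?m"
  proof -
    have "map_pmf Z P = map_pmf snd (map_pmf (\<lambda>\<omega>. (X \<omega>, Z \<omega>)) P)"
      by (simp add: pmf.map_comp o_def)
    also have "\<dots> = ?m"
      unfolding law mixture_def by (simp add: map_bind_pmf bind_return_pmf')
    finally show ?thesis .
  qed
  have joint: "measure_pmf.prob P {\<omega>. X \<omega> = x \<and> Z \<omega> = z} = pmf (M x) z / real q" if "x \<in> Zmod q" for x z
  proof -
    have "measure_pmf.prob P {\<omega>. X \<omega> = x \<and> Z \<omega> = z} = pmf (map_pmf (\<lambda>\<omega>. (X \<omega>, Z \<omega>)) P) (x, z)"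
      unfolding pmf_map by (intro arg_cong2[where f = measure]) auto
    also have "\<dots> = (\<Sum>y\<in>Zmod q. pmf (map_pmf (Pair y) (M y)) (x, z)) / real q"
      unfolding law using q by (subst pmf_bind_pmf_of_set) (auto simp: map_pmf_def)
    also have "(\<Sum>y\<in>Zmod q. pmf (map_pmf (Pair y) (M y)) (x, z)) = (\<Sum>y\<in>Zmod q. if y = x then pmf (M y) z else 0)"
    proof (intro sum.cong refl)
      fix y
      show "pmf (map_pmf (Pair y) (M y)) (x, z) = (if y = x then pmf (M y) z else 0)"
      proof (cases "y = x")
        case True
        then show ?thesis using pmf_map_inj'[of "Pair x" "M x" z] by (simp add: inj_on_def)
      next
        case False
        then have "(x, z) \<notin> set_pmf (map_pmf (Pair y) (M y))" by auto
        then show ?thesis using False by (simp add: set_pmf_eq)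
      qed
    qed
    also have "\<dots> = pmf (M x) z" using that by simp
    finally show ?thesis .
  qed
  have post: "?post z x = (1 + excess q M x z) / real q" if "x \<in> Zmod q" for x z
  proof -
    have "measure_pmf.prob P {\<omega>. Z \<omega> = z} = pmf ?m z"
      unfolding Zlaw[symmetric] pmf_map by (intro arg_cong2[where f = measure]) auto
    then show ?thesis using joint[OF that, of z] by (simp add: cond_prob_def excess_def)
  qed
  have TV: "(d_TV (Zmod q) (?post z) (pmf (pmf_of_set (Zmod q))))\<^sup>2 \<le> (\<Sum>x\<in>Zmod q. (excess q M x z)\<^sup>2) / real q" for z
  proof -
    have "d_TV (Zmod q) (?post z) (pmf (pmf_of_set (Zmod q)))
       = d_TV (Zmod q) (\<lambda>x. (1 + excess q M x z) / real q) (\<lambda>x. 1 / real q)"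
      unfolding d_TV_def using q
      by (intro arg_cong2[where f = "(/)"] sum.cong refl) (simp add: post)
    then show ?thesis using d_TV_sq_le[OF q] by simp
  qed
  have "measure_pmf.expectation P (\<lambda>\<omega>. (d_TV (Zmod q) (?post (Z \<omega>)) (pmf (pmf_of_set (Zmod q))))\<^sup>2)
      = measure_pmf.expectation ?m (\<lambda>z. (d_TV (Zmod q) (?post z) (pmf (pmf_of_set (Zmod q))))\<^sup>2)"
    unfolding Zlaw[symmetric] by simp
  also have "\<dots> \<le> chi2 q M"
    unfolding chi2_def using finite_mixture[OF q fin] TV
    by (intro integral_mono integrable_measure_pmf_finite)
  finally show ?thesis .
qed

section \<open>Recursion on trees\<close>

lemma chi2_return_const: "chi2 q (\<lambda>_. return_pmf z) = 0"
  by (simp add: chi2_def mixture_def excess_def)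

text \<open>With \<open>\<delta> = \<eta> / 2\<close> in the merging bound, the product term is at most \<open>\<delta>\<close> times the first value as soon
as the second value is small. The first value may be arbitrary, so children can be merged one by one.\<close>

lemma chi2_pair_small:
  assumes q: "0 < q" and \<eta>: "0 < \<eta>"
  obtains b where "0 < b"
    "\<And>(M :: int \<Rightarrow> 'a pmf) (N :: int \<Rightarrow> 'b pmf).
      (\<And>x. x \<in> Zmod q \<Longrightarrow> finite (set_pmf (M x))) \<Longrightarrow> (\<And>x. x \<in> Zmod q \<Longrightarrow> finite (set_pmf (N x))) \<Longrightarrow>
      chi2 q N \<le> b \<Longrightarrow> chi2 q (\<lambda>x. pair_pmf (M x) (N x)) \<le> (1 + \<eta>) * (chi2 q M + chi2 q N)"
proof -
  define \<delta> where "\<delta> = \<eta> / 2"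
  define K where "K = (1 + \<delta>) * real q + (1 + \<delta>)\<^sup>2 / (4 * \<delta>) * (real q)\<^sup>2"
  have \<delta>: "0 < \<delta>" using \<eta> by (simp add: \<delta>_def)
  have K: "0 < K" using \<delta> q by (auto simp: K_def intro!: add_pos_nonneg)
  show ?thesis
  proof (rule that[of "\<delta> / K"])
    show "0 < \<delta> / K" using \<delta> K by simp
  next
    fix M :: "int \<Rightarrow> 'a pmf" and N :: "int \<Rightarrow> 'b pmf"
    assume fin: "\<And>x. x \<in> Zmod q \<Longrightarrow> finite (set_pmf (M x))" "\<And>x. x \<in> Zmod q \<Longrightarrow> finite (set_pmf (N x))"
      and small: "chi2 q N \<le> \<delta> / K"
    have "K * chi2 q N \<le> \<delta>" using small K by (simp add: field_simps)
    then have "chi2 q M * (K * chi2 q N) \<le> chi2 q M * \<delta>"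
      by (rule mult_left_mono) (rule chi2_nonneg)
    moreover have "chi2 q (\<lambda>x. pair_pmf (M x) (N x))
       \<le> (1 + \<delta>) * (chi2 q M + chi2 q N) + K * (chi2 q M * chi2 q N)"
      unfolding K_def by (rule chi2_pair_le[OF q \<delta> fin])
    moreover have "0 \<le> \<delta> * chi2 q N" using \<delta> chi2_nonneg[of q N] by simp
    ultimately show "chi2 q (\<lambda>x. pair_pmf (M x) (N x)) \<le> (1 + \<eta>) * (chi2 q M + chi2 q N)"
      by (simp add: \<delta>_def algebra_simps)
  qed
qed

text \<open>A rooted tree on the vertex set \<open>B\<close>, given by its parent function. The depth function excludes cycles of
parents. The edges of \<open>D\<close> inside \<open>B\<close> are the pairs of a vertex and its parent, each in one direction;
edges of \<open>D\<close> that leave \<open>B\<close> are unrestricted.\<close>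

locale rooted_tree =
  fixes B :: "nat set" and root :: nat and parent depth :: "nat \<Rightarrow> nat" and D :: "nat rel"
  assumes finite_B: "finite B" and root_in: "root \<in> B"
    and parent_in: "\<And>x. x \<in> B \<Longrightarrow> x \<noteq> root \<Longrightarrow> parent x \<in> B"
    and depth_parent: "\<And>x. x \<in> B \<Longrightarrow> x \<noteq> root \<Longrightarrow> depth x = Suc (depth (parent x))"
    and edge_parent: "\<And>a b. (a, b) \<in> D \<Longrightarrow> a \<in> B \<Longrightarrow> b \<in> B \<Longrightarrow>
        b \<noteq> root \<and> a = parent b \<or> a \<noteq> root \<and> b = parent a"
    and parent_edge: "\<And>x. x \<in> B \<Longrightarrow> x \<noteq> root \<Longrightarrow> ((x, parent x) \<in> D) \<noteq> ((parent x, x) \<in> D)"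
begin

inductive_set desc :: "nat \<Rightarrow> nat set" for v where
  desc_self: "v \<in> desc v"
| desc_step: "parent x \<in> desc v \<Longrightarrow> x \<in> B \<Longrightarrow> x \<noteq> root \<Longrightarrow> x \<in> desc v"

definition children :: "nat \<Rightarrow> nat set" where
  "children v = {c \<in> B. c \<noteq> root \<and> parent c = v}"

lemma finite_children: "finite (children v)"
  using finite_B by (simp add: children_def)

lemma desc_subset: "v \<in> B \<Longrightarrow> desc v \<subseteq> B"
  by (auto elim: desc.cases)

lemma finite_desc: "v \<in> B \<Longrightarrow> finite (desc v)"
  using desc_subset finite_B by (rule finite_subset)

lemma depth_desc: "x \<in> desc v \<Longrightarrow> depth v \<le> depth x"
  by (induction rule: desc.induct) (auto simp: depth_parent)

lemma desc_cases: "x \<in> desc v \<Longrightarrow> x = v \<or> parent x \<in> desc v \<and> x \<in> B \<and> x \<noteq> root"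
  by (auto elim: desc.cases)

text \<open>The depth tells how many parents must be taken to get from \<open>x\<close> to \<open>c\<close>, so \<open>c\<close> is determined by \<open>x\<close>.\<close>

lemma desc_disjoint:
  assumes "x \<in> desc c" "x \<in> desc c'" "depth c = depth c'"
  shows "c = c'"
  using assms
proof (induction rule: desc.induct)
  case desc_self
  then show ?case using desc_cases[of c c'] depth_desc[of "parent c" c'] depth_parent[of c] by auto
next
  case (desc_step x)
  then show ?case using desc_cases[of x c'] depth_desc[of "parent x" c] depth_parent[of x] by auto
qed

lemma desc_children_subset: "c \<in> children v \<Longrightarrow> desc c \<subseteq> desc v"
proof
  fix x assume c: "c \<in> children v" and "x \<in> desc c"
  from this(2) show "x \<in> desc v"
    by (induction rule: desc.induct) (use c in \<open>auto simp: children_def intro: desc.intros\<close>)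
qed

lemma depth_children: "c \<in> children v \<Longrightarrow> depth c = Suc (depth v)"
  by (auto simp: children_def depth_parent)

lemma not_in_desc_child: "c \<in> children v \<Longrightarrow> v \<notin> desc c"
  using depth_desc[of v c] depth_children[of c v] by auto

lemma desc_unfold: "desc v = insert v (\<Union>c\<in>children v. desc c)"
proof (intro equalityI subsetI)
  fix x assume "x \<in> desc v"
  then show "x \<in> insert v (\<Union>c\<in>children v. desc c)"
  proof (induction rule: desc.induct)
    case (desc_step x)
    then show ?case by (auto simp: children_def intro: desc.intros)
  qed simp
qed (use desc_children_subset in \<open>auto intro: desc.intros\<close>)

lemma desc_root: "desc root = B"
proof
  show "desc root \<subseteq> B" by (rule desc_subset[OF root_in])
  have "x \<in> B \<Longrightarrow> x \<in> desc root" for x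
  proof (induction "depth x" arbitrary: x rule: less_induct)
    case less
    show ?case
    proof (cases "x = root")
      case False
      with less have "parent x \<in> desc root" using parent_in depth_parent by auto
      then show ?thesis using False less.prems desc_step by blast
    qed (simp add: desc_self)
  qed
  then show "B \<subseteq> desc root" by blast
qed

text \<open>The subtrees of the children of \<open>v\<close> are attached one at a time; a bush is an intermediate stage of
this process.\<close>

definition bush :: "nat \<Rightarrow> nat set \<Rightarrow> nat set" where
  "bush v A = insert v (\<Union>c\<in>A. desc c)"

lemma no_loop: "v \<in> B \<Longrightarrow> (v, v) \<notin> D"
  using edge_parent[of v v] depth_parent[of v] by auto

lemma bush_disjoint:
  assumes "A \<subseteq> children v" "c \<in> children v" "c \<notin> A"
  shows "bush v A \<inter> desc c = {}"
proof -
  have False if x: "x \<in> bush v A" and xc: "x \<in> desc c" for x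
  proof (cases "x = v")
    case True
    then show ?thesis using xc not_in_desc_child assms by auto
  next
    case False
    then obtain c' where "c' \<in> A" "x \<in> desc c'" using x unfolding bush_def by blast
    then show ?thesis using xc desc_disjoint[of x c c'] assms by (auto simp: depth_children subset_iff)
  qed
  then show ?thesis by blast
qed

text \<open>Since every edge joins a vertex to its parent, the only edge between the bush and a new subtree leads to its root.\<close>

lemma edges_bush_insert:
  assumes v: "v \<in> B" and A: "A \<subseteq> children v" and c: "c \<in> children v" "c \<notin> A"
  obtains e where "e = (v, c) \<or> e = (c, v)"
    "D \<inter> bush v (insert c A) \<times> bush v (insert c A)
      = (D \<inter> bush v A \<times> bush v A) \<union> insert e (D \<inter> desc c \<times> desc c)"
proof -
  have cB: "c \<in> B" "c \<noteq> root" "parent c = v" using c by (auto simp: children_def)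
  define e where "e = (if (v, c) \<in> D then (v, c) else (c, v))"
  have e: "e \<in> D" "e = (v, c) \<or> e = (c, v)" "(v, c) \<in> D \<Longrightarrow> e = (v, c)" "(c, v) \<in> D \<Longrightarrow> e = (c, v)"
    using parent_edge[OF cB(1,2)] cB(3) by (auto simp: e_def)
  have bB: "bush v A \<subseteq> B"
    using A v desc_subset by (auto simp: bush_def children_def)
  have dB: "desc c \<subseteq> B" by (rule desc_subset[OF cB(1)])
  have disj: "bush v A \<inter> desc c = {}" by (rule bush_disjoint[OF A c])
  have cross: "a = v \<and> b = c"
    if aA: "a \<in> bush v A" and bc: "b \<in> desc c" and abD: "(a, b) \<in> D \<or> (b, a) \<in> D" for a b
  proof -
    have "b \<noteq> root \<and> a = parent b \<or> a \<noteq> root \<and> b = parent a"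
      using aA bc abD edge_parent[of a b] edge_parent[of b a] bB dB by auto
    then show ?thesis
    proof (elim disjE conjE)
      assume "a = parent b"
      then show ?thesis using desc_cases[OF bc] cB(3) disj aA by auto
    next
      assume a: "a \<noteq> root" "b = parent a"
      have aB: "a \<in> B" using aA bB by auto
      show ?thesis
      proof (cases "a = v")
        case True
        then show ?thesis
          using depth_desc[OF bc] a depth_parent[OF aB a(1)] depth_children[OF c(1)] by simp
      next
        case False
        then obtain c' where c': "c' \<in> A" "a \<in> desc c'" using aA unfolding bush_def by blast
        have "b \<in> bush v A"
          using desc_cases[OF c'(2)] a c' A by (auto simp: bush_def children_def)
        then show ?thesis using bc disj by auto
      qed
    qed
  qed
  have U: "bush v (insert c A) = bush v A \<union> desc c" by (auto simp: bush_def)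
  have "D \<inter> bush v (insert c A) \<times> bush v (insert c A)
      = (D \<inter> bush v A \<times> bush v A) \<union> insert e (D \<inter> desc c \<times> desc c)"
  proof (intro equalityI subsetI)
    fix z assume z: "z \<in> D \<inter> bush v (insert c A) \<times> bush v (insert c A)"
    obtain a b where ab: "z = (a, b)" by (cases z)
    show "z \<in> (D \<inter> bush v A \<times> bush v A) \<union> insert e (D \<inter> desc c \<times> desc c)"
      using z cross[of a b] cross[of b a] e(3,4) unfolding ab U by blast
  next
    fix z assume "z \<in> (D \<inter> bush v A \<times> bush v A) \<union> insert e (D \<inter> desc c \<times> desc c)"
    then show "z \<in> D \<inter> bush v (insert c A) \<times> bush v (insert c A)"
      using e(1,2) desc_self[of c] unfolding U by (auto simp: bush_def)
  qed
  then show ?thesis using that e(2) by blast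
qed

text \<open>Each child contributes at most \<open>(1 - p)\<^sup>2 a\<close> through its edge to \<open>v\<close>, and each of the merging steps costs
a factor \<open>1 + \<eta>\<close>. The side information at \<open>v\<close> itself is left out.\<close>

lemma chi2_bush_le:
  assumes q: "0 < q" and p: "0 \<le> p" "p \<le> 1" and \<eta>: "0 \<le> \<eta>" and a: "0 \<le> a"
    and merge: "\<And>(M :: int \<Rightarrow> obs pmf) (N :: int \<Rightarrow> obs pmf).
      (\<And>x. x \<in> Zmod q \<Longrightarrow> finite (set_pmf (M x))) \<Longrightarrow> (\<And>x. x \<in> Zmod q \<Longrightarrow> finite (set_pmf (N x))) \<Longrightarrow>
      chi2 q N \<le> b \<Longrightarrow> chi2 q (\<lambda>x. pair_pmf (M x) (N x)) \<le> (1 + \<eta>) * (chi2 q M + chi2 q N)"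
    and ab: "(1 - p)\<^sup>2 * a \<le> b" and v: "v \<in> B"
    and "finite A" and "A \<subseteq> children v"
    and "\<And>c. c \<in> A \<Longrightarrow> chi2 q (obs_law q p \<epsilon> (desc c) (desc c) (D \<inter> desc c \<times> desc c) c) \<le> a"
  shows "chi2 q (obs_law q p \<epsilon> (bush v A) (bush v A - {v}) (D \<inter> bush v A \<times> bush v A) v)
    \<le> (1 + \<eta>) ^ card A * (real (card A) * ((1 - p)\<^sup>2 * a))"
  using assms(9-)
proof (induction A rule: finite_induct)
  case empty
  have "D \<inter> {v} \<times> {v} = {}" using no_loop[OF v] by auto
  then have "obs_law q p \<epsilon> (bush v {}) (bush v {} - {v}) (D \<inter> bush v {} \<times> bush v {}) v
     = (\<lambda>_. return_pmf (\<lambda>_. 0, \<lambda>_. None))"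
    by (simp add: bush_def obs_law_def obs_given_def bind_return_pmf fun_eq_iff)
  then show ?case by (simp add: chi2_return_const)
next
  case (insert c A)
  let ?S = "bush v A" and ?T = "bush v (insert c A)"
  let ?b = "(1 - p)\<^sup>2 * a"
  have A: "A \<subseteq> children v" and c: "c \<in> children v" "c \<notin> A" using insert by auto
  have cB: "c \<in> B" using c by (auto simp: children_def)
  have IH: "chi2 q (obs_law q p \<epsilon> ?S (?S - {v}) (D \<inter> ?S \<times> ?S) v)
      \<le> (1 + \<eta>) ^ card A * (real (card A) * ?b)" using insert A by auto
  obtain e where e: "e = (v, c) \<or> e = (c, v)"
    and edges: "D \<inter> ?T \<times> ?T = (D \<inter> ?S \<times> ?S) \<union> insert e (D \<inter> desc c \<times> desc c)"
    by (rule edges_bush_insert[OF v A c])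
  have disj: "?S \<inter> desc c = {}" by (rule bush_disjoint[OF A c])
  have vc: "v \<notin> desc c" by (rule not_in_desc_child[OF c(1)])
  have T: "?T = ?S \<union> insert v (desc c)" "?T - {v} = (?S - {v}) \<union> desc c"
    using vc by (auto simp: bush_def)
  have finS: "finite ?S" using insert.hyps A finite_desc by (auto simp: bush_def children_def)
  have finc: "finite (desc c)" by (rule finite_desc[OF cB])
  let ?M = "obs_law q p \<epsilon> ?S (?S - {v}) (D \<inter> ?S \<times> ?S) v"
  let ?N = "obs_law q p \<epsilon> (insert v (desc c)) (desc c) (insert e (D \<inter> desc c \<times> desc c)) v"
  have finM: "finite (set_pmf (?M x))" and finN: "finite (set_pmf (?N x))" for x
    using finS finc q by (auto intro!: finite_set_obs_law)
  have "obs_law q p \<epsilon> ?T (?T - {v}) (D \<inter> ?T \<times> ?T) v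
     = (\<lambda>x. map_pmf (union_obs (?S - {v}) (D \<inter> ?S \<times> ?S)) (pair_pmf (?M x) (?N x)))"
    unfolding edges T(2) unfolding T(1)
  proof (rule ext, rule obs_law_glue)
    show "?S \<inter> insert v (desc c) = {v}" using disj by (auto simp: bush_def)
    show "insert e (D \<inter> desc c \<times> desc c) \<subseteq> insert v (desc c) \<times> insert v (desc c)"
      using e by (auto intro: desc_self)
    have "c \<notin> ?S" using disj desc_self[of c] by auto
    then show "D \<inter> ?S \<times> ?S \<inter> insert e (D \<inter> desc c \<times> desc c) = {}"
      using e disj by auto
  qed (use disj finS finc in auto)
  then have "chi2 q (obs_law q p \<epsilon> ?T (?T - {v}) (D \<inter> ?T \<times> ?T) v) \<le> chi2 q (\<lambda>x. pair_pmf (?M x) (?N x))"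
    using chi2_map_le[OF q, of "\<lambda>x. pair_pmf (?M x) (?N x)"] finM finN by simp
  also have N: "chi2 q ?N \<le> ?b"
  proof -
    have "chi2 q ?N \<le> (1 - p)\<^sup>2 * chi2 q (obs_law q p \<epsilon> (desc c) (desc c) (D \<inter> desc c \<times> desc c) c)"
      by (rule chi2_extend_le[OF q p finc vc desc_self _ e]) auto
    also have "\<dots> \<le> ?b" using insert.prems by (intro mult_left_mono) auto
    finally show ?thesis .
  qed
  then have "chi2 q (\<lambda>x. pair_pmf (?M x) (?N x)) \<le> (1 + \<eta>) * (chi2 q ?M + chi2 q ?N)"
    by (intro merge finM finN order_trans[OF _ ab])
  also have "\<dots> \<le> (1 + \<eta>) * ((1 + \<eta>) ^ card A * (real (card A) * ?b) + (1 + \<eta>) ^ card A * ?b)"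
  proof -
    have "1 * ?b \<le> (1 + \<eta>) ^ card A * ?b"
      using \<eta> a by (intro mult_right_mono one_le_power) auto
    then show ?thesis using IH N \<eta> by (intro mult_left_mono add_mono) auto
  qed
  also have "\<dots> = (1 + \<eta>) ^ card (insert c A) * (real (card (insert c A)) * ?b)"
    using insert.hyps by (simp add: algebra_simps)
  finally show ?case .
qed

text \<open>The value \<open>a = \<epsilon> q / (1 - \<kappa>)\<close> is the fixed point of \<open>a \<mapsto> \<epsilon> q + \<kappa> a\<close>, which dominates one step of the
recursion at a vertex with at most \<open>j\<close> children. By induction from the leaves it bounds the
information at every vertex other than the root. The root, with up to \<open>k\<close> children, is treated by one
more step that need not contract.\<close>

lemma chi2_root_le:
  assumes q: "0 < q" and p: "0 \<le> p" "p \<le> 1" and \<epsilon>: "0 \<le> \<epsilon>" "\<epsilon> \<le> 1" and \<eta>: "0 \<le> \<eta>"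
    and merge: "\<And>(M :: int \<Rightarrow> obs pmf) (N :: int \<Rightarrow> obs pmf).
      (\<And>x. x \<in> Zmod q \<Longrightarrow> finite (set_pmf (M x))) \<Longrightarrow> (\<And>x. x \<in> Zmod q \<Longrightarrow> finite (set_pmf (N x))) \<Longrightarrow>
      chi2 q N \<le> b \<Longrightarrow> chi2 q (\<lambda>x. pair_pmf (M x) (N x)) \<le> (1 + \<eta>) * (chi2 q M + chi2 q N)"
    and k: "card (children root) \<le> k" and j: "\<And>v. v \<in> B \<Longrightarrow> v \<noteq> root \<Longrightarrow> card (children v) \<le> j"
    and \<kappa>: "(1 + \<eta>) ^ j * (real j * (1 - p)\<^sup>2) \<le> \<kappa>" "\<kappa> < 1"
    and small: "(1 - p)\<^sup>2 * (\<epsilon> * real q / (1 - \<kappa>)) \<le> b"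
  shows "chi2 q (obs_law q p \<epsilon> B B (D \<inter> B \<times> B) root)
    \<le> \<epsilon> * real q + (1 + \<eta>) ^ k * (real k * ((1 - p)\<^sup>2 * (\<epsilon> * real q / (1 - \<kappa>))))"
proof -
  define a where "a = \<epsilon> * real q / (1 - \<kappa>)"
  have a: "0 \<le> a" "\<epsilon> * real q + \<kappa> * a = a"
    using \<epsilon> \<kappa> by (auto simp: a_def field_simps)
  let ?I = "\<lambda>v. chi2 q (obs_law q p \<epsilon> (desc v) (desc v) (D \<inter> desc v \<times> desc v) v)"
  have step: "?I v \<le> \<epsilon> * real q + (1 + \<eta>) ^ m * (real m * ((1 - p)\<^sup>2 * a))"
    if v: "v \<in> B" and IH: "\<And>c. c \<in> children v \<Longrightarrow> ?I c \<le> a" and m: "card (children v) \<le> m" for v m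
  proof -
    have bush: "bush v (children v) = desc v" by (simp add: bush_def flip: desc_unfold)
    have "?I v \<le> \<epsilon> * real q + chi2 q (obs_law q p \<epsilon> (desc v) (desc v - {v}) (D \<inter> desc v \<times> desc v) v)"
      using finite_desc[OF v] by (intro chi2_reveal_root_le q \<epsilon>) (auto intro: desc_self)
    also have "chi2 q (obs_law q p \<epsilon> (desc v) (desc v - {v}) (D \<inter> desc v \<times> desc v) v)
       \<le> (1 + \<eta>) ^ card (children v) * (real (card (children v)) * ((1 - p)\<^sup>2 * a))"
      using chi2_bush_le[OF q p \<eta> a(1) merge _ v finite_children[of v] order_refl IH] small
      unfolding bush a_def by blast
    also have "\<dots> \<le> (1 + \<eta>) ^ m * (real m * ((1 - p)\<^sup>2 * a))"
    proof -
      have b: "0 \<le> real m' * ((1 - p)\<^sup>2 * a)" for m' using a by simp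
      have "real (card (children v)) * ((1 - p)\<^sup>2 * a) \<le> real m * ((1 - p)\<^sup>2 * a)"
        using m a by (intro mult_right_mono) auto
      moreover have "(1 + \<eta>) ^ card (children v) \<le> (1 + \<eta>) ^ m"
        using m \<eta> by (intro power_increasing) auto
      ultimately show ?thesis using b \<eta>
        by (intro mult_mono[of "(1 + \<eta>) ^ card (children v)"]) auto
    qed
    finally show ?thesis by simp
  qed
  have "v \<in> B \<Longrightarrow> v \<noteq> root \<Longrightarrow> ?I v \<le> a" for v
  proof (induction "card (desc v)" arbitrary: v rule: less_induct)
    case less
    have "?I c \<le> a" if c: "c \<in> children v" for c
    proof (rule less.hyps)
      show "card (desc c) < card (desc v)"
        using desc_children_subset[OF c] not_in_desc_child[OF c] desc_self[of v] finite_desc[OF less.prems(1)]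
        by (intro psubset_card_mono) auto
    qed (use c in \<open>auto simp: children_def\<close>)
    then have "?I v \<le> \<epsilon> * real q + (1 + \<eta>) ^ j * (real j * ((1 - p)\<^sup>2 * a))"
      by (intro step less.prems j)
    also have "\<dots> = \<epsilon> * real q + (1 + \<eta>) ^ j * (real j * (1 - p)\<^sup>2) * a"
      by (simp add: mult.assoc)
    also have "\<dots> \<le> \<epsilon> * real q + \<kappa> * a"
      using \<kappa> a by (intro add_left_mono mult_right_mono) auto
    finally show ?case using a by simp
  qed
  then have "?I root \<le> \<epsilon> * real q + (1 + \<eta>) ^ k * (real k * ((1 - p)\<^sup>2 * a))"
    by (intro step root_in k) (auto simp: children_def)
  then show ?thesis unfolding a_def desc_root .
qed

end

section \<open>Existence of regular graphs\<close>

text \<open>A circulant graph joins \<open>i\<close> and \<open>j\<close> when their difference lies in a symmetric set \<open>S\<close> of nonzero residues.\<close>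

lemma circulant_regular:
  fixes S :: "int set"
  assumes S: "S \<subseteq> {1..<int n}" "\<And>s. s \<in> S \<Longrightarrow> int n - s \<in> S"
  defines "E \<equiv> {(i, j). i < n \<and> j < n \<and> (int j - int i) mod int n \<in> S}"
  shows "E \<in> regular_graphs n (card S)"
proof -
  have "sym E"
  proof (rule symI)
    fix i j assume "(i, j) \<in> E"
    then have ij: "i < n" "j < n" and s: "(int j - int i) mod int n \<in> S" by (auto simp: E_def)
    have "(int j - int i) mod int n \<noteq> 0" using s S(1) by auto
    then have "(int i - int j) mod int n = int n - (int j - int i) mod int n"
      using zmod_zminus1_eq_if[of "int j - int i" "int n"] by simp
    then show "(j, i) \<in> E" using ij S(2)[OF s] by (simp add: E_def)
  qed
  moreover have "irrefl E" using S(1) by (auto simp: irrefl_def E_def)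
  moreover have "card (E `` {i}) = card S" if i: "i < n" for i
  proof (rule bij_betw_same_card)
    show "bij_betw (\<lambda>j. (int j - int i) mod int n) (E `` {i}) S"
    proof (rule bij_betw_byWitness[where f' = "\<lambda>s. nat ((int i + s) mod int n)"])
      show "\<forall>j\<in>E `` {i}. nat ((int i + (int j - int i) mod int n) mod int n) = j"
        by (auto simp: E_def mod_simps)
      have inv: "((int i + s) mod int n - int i) mod int n = s" if "s \<in> S" for s
        using that S(1) by (auto simp: mod_simps)
      then show "\<forall>s\<in>S. (int (nat ((int i + s) mod int n)) - int i) mod int n = s"
        using i by auto
      show "(\<lambda>s. nat ((int i + s) mod int n)) ` S \<subseteq> E `` {i}"
        using i inv by (auto simp: E_def nat_less_iff)
    qed (auto simp: E_def)
  qed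
  ultimately show ?thesis by (auto simp: regular_graphs_def E_def)
qed

text \<open>The differences are \<open>\<plusminus>1, \<dots>, \<plusminus>h\<close> and, if \<open>k\<close> is odd, the antipodal residue \<open>n / 2\<close>.\<close>

lemma regular_graphs_nonempty:
  assumes "k < n" "even (n * k)"
  shows "regular_graphs n k \<noteq> {}"
proof -
  define h where "h = k div 2"
  let ?T = "{1..int h} \<union> {int n - int h..<int n}"
  have "2 * h \<le> k" by (simp add: h_def)
  then have T: "card ?T = 2 * h" using assms(1) by (subst card_Un_disjoint) auto
  show ?thesis
  proof (cases "even k")
    case True
    then have k: "k = 2 * h" by (simp add: h_def)
    have "card ?T = k" using T k by simp
    moreover have "?T \<subseteq> {1..<int n}" using assms(1) k by auto
    moreover have "int n - s \<in> ?T" if "s \<in> ?T" for s using that by auto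
    ultimately show ?thesis using circulant_regular[of ?T n] by auto
  next
    case False
    then have k: "k = 2 * h + 1" by (auto simp: h_def elim: oddE)
    obtain m where n: "n = 2 * m" using False assms(2) by auto
    let ?U = "insert (int m) ?T"
    have "card ?U = k"
      using T assms(1) k n by (subst card_insert_disjoint) auto
    moreover have "?U \<subseteq> {1..<int n}" using assms(1) k n by auto
    moreover have "int n - s \<in> ?U" if "s \<in> ?U" for s using that n by auto
    ultimately show ?thesis using circulant_regular[of ?U n] by auto
  qed
qed

section \<open>Switchings\<close>

lemma regular_graphsD:
  assumes "E \<in> regular_graphs n k"
  shows "E \<subseteq> {..<n} \<times> {..<n}" "finite E" "sym E" "irrefl E" "u < n \<Longrightarrow> card (E `` {u}) = k"
    "finite (E `` {u})"
proof -
  show *: "E \<subseteq> {..<n} \<times> {..<n}" "sym E" "irrefl E" "u < n \<Longrightarrow> card (E `` {u}) = k"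
    using assms by (auto simp: regular_graphs_def)
  then show "finite E" by (auto intro: finite_subset)
  then show "finite (E `` {u})" by (rule finite_Image)
qed

lemma finite_regular_graphs: "finite (regular_graphs n k)"
  by (rule finite_subset[of _ "Pow ({..<n} \<times> {..<n})"]) (auto simp: regular_graphs_def)

lemma degree_le: "E \<in> regular_graphs n k \<Longrightarrow> card (E `` {u}) \<le> k"
proof (cases "u < n")
  case False
  assume "E \<in> regular_graphs n k"
  then have "E `` {u} = {}" using regular_graphsD(1)[of E n k] False by auto
  then show ?thesis by simp
qed (simp add: regular_graphsD(5))

lemma card_regular_graph: "E \<in> regular_graphs n k \<Longrightarrow> card E = n * k"
proof -
  assume E: "E \<in> regular_graphs n k"
  have "E = Sigma {..<n} (\<lambda>u. E `` {u})" using regular_graphsD(1)[OF E] by auto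
  then have "card E = (\<Sum>u<n. card (E `` {u}))"
    using regular_graphsD(6)[OF E] by (metis card_SigmaI finite_lessThan)
  then show ?thesis by (simp add: regular_graphsD(5)[OF E])
qed

text \<open>The edges \<open>xy\<close> and \<open>ab\<close> are replaced by \<open>xa\<close> and \<open>yb\<close>, which preserves all degrees.\<close>

definition switch :: "nat \<Rightarrow> nat \<Rightarrow> nat \<Rightarrow> nat \<Rightarrow> nat rel \<Rightarrow> nat rel" where
  "switch x y a b E = (E - {(x, y), (y, x), (a, b), (b, a)}) \<union> {(x, a), (a, x), (y, b), (b, y)}"

lemma switch_switch:
  assumes "{(x, y), (y, x), (a, b), (b, a)} \<subseteq> E" "{(x, a), (a, x), (y, b), (b, y)} \<inter> E = {}"
  shows "switch x a y b (switch x y a b E) = E"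
  using assms unfolding switch_def by blast

lemma switch_regular:
  assumes E: "E \<in> regular_graphs n k" and xy: "(x, y) \<in> E" and ab: "(a, b) \<in> E"
    and ne: "a \<noteq> x" "a \<noteq> y" "b \<noteq> x" "b \<noteq> y" and new: "(x, a) \<notin> E" "(y, b) \<notin> E"
  shows "switch x y a b E \<in> regular_graphs n k"
proof -
  note E' = regular_graphsD[OF E]
  have inv: "(y, x) \<in> E" "(b, a) \<in> E" "(a, x) \<notin> E" "(b, y) \<notin> E"
    using E'(3) xy ab new by (auto dest: symD)
  have ne': "x \<noteq> y" "a \<noteq> b" using E'(4) xy ab by (auto simp: irrefl_def)
  have swap: "card (insert c (A - {d})) = card A" if "finite A" "d \<in> A" "c \<notin> A" for A and c d :: nat
    using that card_Suc_Diff1[of A d] by simp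
  have "card (switch x y a b E `` {w}) = k" if w: "w < n" for w
  proof -
    consider "w = x" | "w = y" | "w = a" | "w = b" | "w \<notin> {x, y, a, b}" by auto
    then have "card (switch x y a b E `` {w}) = card (E `` {w})"
    proof cases
      case 1
      have "switch x y a b E `` {w} = insert a (E `` {w} - {y})"
        using 1 ne ne' by (auto simp: switch_def)
      then show ?thesis using swap[OF E'(6)] 1 xy new by simp
    next
      case 2
      have "switch x y a b E `` {w} = insert b (E `` {w} - {x})"
        using 2 ne ne' by (auto simp: switch_def)
      then show ?thesis using swap[OF E'(6)] 2 inv new by simp
    next
      case 3
      have "switch x y a b E `` {w} = insert x (E `` {w} - {b})"
        using 3 ne ne' by (auto simp: switch_def)
      then show ?thesis using swap[OF E'(6)] 3 inv ab by simp
    next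
      case 4
      have "switch x y a b E `` {w} = insert y (E `` {w} - {a})"
        using 4 ne ne' by (auto simp: switch_def)
      then show ?thesis using swap[OF E'(6)] 4 inv ab by simp
    next
      case 5
      then have "switch x y a b E `` {w} = E `` {w}" by (auto simp: switch_def)
      then show ?thesis by simp
    qed
    then show ?thesis using E'(5)[OF w] by simp
  qed
  moreover have "switch x y a b E \<subseteq> {..<n} \<times> {..<n}"
    using E'(1) xy ab by (auto simp: switch_def)
  moreover have "sym (switch x y a b E)"
    using E'(3) unfolding switch_def sym_def by blast
  moreover have "irrefl (switch x y a b E)"
    using E'(4) ne unfolding switch_def irrefl_def by blast
  ultimately show ?thesis by (auto simp: regular_graphs_def)
qed

text \<open>Double counting of switchings that destroy the edge \<open>xy\<close> and keep \<open>F\<close>. A graph containing \<open>F\<close> and \<open>xy\<close>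
has at least \<open>n k - 2 k (k + 1) - 2 |F|\<close> ordered edges \<open>(a, b)\<close> with which \<open>xy\<close> can be switched: excluded
are those starting at \<open>x\<close> or a neighbour of \<open>x\<close>, those ending at \<open>y\<close> or a neighbour of \<open>y\<close>, and those
in \<open>F\<close> in either direction. Conversely, the result of the switching still contains \<open>F\<close>, and the
switching can be undone knowing \<open>a\<close> and \<open>b\<close>, which are then neighbours of \<open>x\<close> and of \<open>y\<close>: at most
\<open>k\<^sup>2\<close> choices.\<close>

lemma extra_edge_rare:
  assumes F: "finite F" "(x, y) \<notin> F" "(y, x) \<notin> F"
  shows "card {E \<in> regular_graphs n k. F \<subseteq> E \<and> (x, y) \<in> E} * (n * k - (2 * k * (k + 1) + 2 * card F))
    \<le> k\<^sup>2 * card {E \<in> regular_graphs n k. F \<subseteq> E}" (is "card ?A * ?c \<le> k\<^sup>2 * card ?A'")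
proof -
  define T where "T = (\<lambda>E. {(a, b). (a, b) \<in> E \<and> a \<noteq> x \<and> a \<noteq> y \<and> b \<noteq> x \<and> b \<noteq> y \<and>
      (x, a) \<notin> E \<and> (y, b) \<notin> E \<and> (a, b) \<notin> F \<and> (b, a) \<notin> F})"
  have finA: "finite ?A" "finite ?A'" using finite_regular_graphs[of n k] by auto
  have T: "?c \<le> card (T E)" "finite (T E)" if "E \<in> ?A" for E
  proof -
    have E: "E \<in> regular_graphs n k" and xy: "(x, y) \<in> E" using that by auto
    note E' = regular_graphsD[OF E]
    show finT: "finite (T E)" using E'(2) by (rule finite_subset[rotated]) (auto simp: T_def)
    \<comment> \<open>\<open>X\<close> and \<open>Y\<inverse>\<close> also cover \<open>a = y\<close> and \<open>b = x\<close>, as \<open>x\<close> and \<open>y\<close> are neighbours.\<close>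
    define X where "X = Sigma (insert x (E `` {x})) (\<lambda>a. E `` {a})"
    define Y where "Y = Sigma (insert y (E `` {y})) (\<lambda>b. E `` {b})"
    have Sig: "card (Sigma (insert v (E `` {v})) (\<lambda>a. E `` {a})) \<le> k * (k + 1)"
      "finite (Sigma (insert v (E `` {v})) (\<lambda>a. E `` {a}))" for v
    proof -
      have "card (insert v (E `` {v})) \<le> k + 1"
        using degree_le[OF E, of v] card_insert_le_m1[of "k + 1" "E `` {v}" v] by simp
      moreover have "card (Sigma (insert v (E `` {v})) (\<lambda>a. E `` {a})) \<le> card (insert v (E `` {v})) * k"
        using E'(6) degree_le[OF E] by (subst card_SigmaI) (auto intro!: sum_bounded_above[where K = k, simplified])
      ultimately show "card (Sigma (insert v (E `` {v})) (\<lambda>a. E `` {a})) \<le> k * (k + 1)"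
        by (metis (no_types, lifting) le_trans mult.commute mult_le_mono1)
      show "finite (Sigma (insert v (E `` {v})) (\<lambda>a. E `` {a}))" using E'(6) by auto
    qed
    have yx: "(y, x) \<in> E" using xy E'(3) by (auto dest: symD)
    have "E \<subseteq> T E \<union> (X \<union> (Y\<inverse> \<union> (F \<union> F\<inverse>)))"
    proof
      fix e assume e: "e \<in> E"
      obtain a b where ab: "e = (a, b)" by (cases e)
      have "(b, a) \<in> E" using e ab E'(3) by (auto dest: symD)
      then show "e \<in> T E \<union> (X \<union> (Y\<inverse> \<union> (F \<union> F\<inverse>)))"
        using e xy yx unfolding ab T_def X_def Y_def by auto
    qed
    then have "card E \<le> card (T E \<union> (X \<union> (Y\<inverse> \<union> (F \<union> F\<inverse>))))"
      using finT Sig(2) F(1) by (intro card_mono) (auto simp: X_def Y_def)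
    also have "\<dots> \<le> card (T E) + (card X + (card Y + (card F + card F)))"
      using Sig(2)[of y] F(1)
      by (intro order_trans[OF card_Un_le] add_mono order_refl) (auto simp: Y_def)
    also have "\<dots> \<le> card (T E) + (k * (k + 1) + (k * (k + 1) + (card F + card F)))"
      unfolding X_def Y_def by (intro add_mono Sig order_refl)
    finally show "?c \<le> card (T E)" by (simp add: card_regular_graph[OF E])
  qed
  have "card ?A * ?c = (\<Sum>E\<in>?A. ?c)" by simp
  also have "\<dots> \<le> (\<Sum>E\<in>?A. card (T E))" by (intro sum_mono T)
  also have "\<dots> = card (Sigma ?A T)" using finA T by (subst card_SigmaI) auto
  also have "\<dots> \<le> card (Sigma ?A' (\<lambda>E. E `` {x} \<times> E `` {y}))"
  proof (rule card_inj_on_le)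
    have old: "{(x, y), (y, x), (a, b), (b, a)} \<subseteq> E" "{(x, a), (a, x), (y, b), (b, y)} \<inter> E = {}"
      if "E \<in> ?A" "(a, b) \<in> T E" for E a b
      using that regular_graphsD(3)[of E n k] by (auto simp: T_def dest: symD)
    show "inj_on (\<lambda>(E, a, b). (switch x y a b E, a, b)) (Sigma ?A T)"
    proof (rule inj_onI)
      fix z z' assume z: "z \<in> Sigma ?A T" "z' \<in> Sigma ?A T"
        and eq: "(case z of (E, a, b) \<Rightarrow> (switch x y a b E, a, b)) = (case z' of (E, a, b) \<Rightarrow> (switch x y a b E, a, b))"
      obtain E a b where Z: "z = (E, a, b)" by (cases z)
      then obtain E' where Z': "z' = (E', a, b)" using eq by (cases z') auto
      have A: "E \<in> ?A" "(a, b) \<in> T E" "E' \<in> ?A" "(a, b) \<in> T E'" using z Z Z' by blast+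
      have "switch x y a b E = switch x y a b E'" using eq Z Z' by simp
      then have "E = E'"
        using switch_switch[OF old[OF A(1,2)]] switch_switch[OF old[OF A(3,4)]] by metis
      then show "z = z'" using Z Z' by simp
    qed
    show "(\<lambda>(E, a, b). (switch x y a b E, a, b)) ` Sigma ?A T \<subseteq> Sigma ?A' (\<lambda>E. E `` {x} \<times> E `` {y})"
    proof
      fix z' assume "z' \<in> (\<lambda>(E, a, b). (switch x y a b E, a, b)) ` Sigma ?A T"
      then obtain z where z: "z \<in> Sigma ?A T" "z' = (case z of (E, a, b) \<Rightarrow> (switch x y a b E, a, b))" by blast
      obtain E a b where Z: "z = (E, a, b)" by (cases z)
      have E: "E \<in> regular_graphs n k" "F \<subseteq> E" "(x, y) \<in> E" "(a, b) \<in> T E" using z Z by auto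
      have "switch x y a b E \<in> regular_graphs n k"
        using E by (intro switch_regular) (auto simp: T_def)
      moreover have "F \<subseteq> switch x y a b E"
        using E F by (auto simp: T_def switch_def)
      moreover have "(x, a) \<in> switch x y a b E" "(y, b) \<in> switch x y a b E"
        by (auto simp: switch_def)
      ultimately show "z' \<in> Sigma ?A' (\<lambda>E. E `` {x} \<times> E `` {y})"
        using z Z by auto
    qed
    show "finite (Sigma ?A' (\<lambda>E. E `` {x} \<times> E `` {y}))"
      using finA regular_graphsD(6) by (intro finite_SigmaI finite_cartesian_product) auto
  qed
  also have "\<dots> = (\<Sum>E\<in>?A'. card (E `` {x} \<times> E `` {y}))"
    using finA regular_graphsD(6) by (intro card_SigmaI ballI finite_cartesian_product) auto
  also have "\<dots> \<le> (\<Sum>E\<in>?A'. k * k)"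
    using degree_le by (intro sum_mono) (auto simp: card_cartesian_product intro!: mult_le_mono)
  also have "\<dots> = k\<^sup>2 * card ?A'" by (simp add: power2_eq_square)
  finally show ?thesis .
qed

section \<open>Tree-like balls\<close>

text \<open>Walks are written backwards: the end vertex comes first.\<close>

definition steps :: "nat list \<Rightarrow> nat rel" where
  "steps w = set (zip w (tl w))"

definition walks :: "nat rel \<Rightarrow> nat \<Rightarrow> nat \<Rightarrow> nat list set" where
  "walks E u m = {w. length w = Suc m \<and> last w = u \<and> steps w \<subseteq> E}"

lemma steps_Cons: "w \<noteq> [] \<Longrightarrow> steps (v # w) = insert (v, hd w) (steps w)"
  by (cases w) (auto simp: steps_def)

lemma walks_0: "walks E u 0 = {[u]}"
  by (auto simp: walks_def steps_def length_Suc_conv)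

lemma walks_Suc: "walks E u (Suc m) = (\<Union>w\<in>walks E u m. (\<lambda>v. v # w) ` {v. (v, hd w) \<in> E})"
proof (intro equalityI subsetI)
  fix w assume "w \<in> walks E u (Suc m)"
  then obtain v w' where w: "w = v # w'" "length w' = Suc m" by (auto simp: walks_def length_Suc_conv)
  then have "w' \<noteq> []" by auto
  then show "w \<in> (\<Union>w\<in>walks E u m. (\<lambda>v. v # w) ` {v. (v, hd w) \<in> E})"
    using \<open>w \<in> walks E u (Suc m)\<close> w by (auto simp: walks_def steps_Cons)
next
  fix w assume "w \<in> (\<Union>w\<in>walks E u m. (\<lambda>v. v # w) ` {v. (v, hd w) \<in> E})"
  then obtain w' v where w: "w = v # w'" "w' \<in> walks E u m" "(v, hd w') \<in> E" by auto
  then have "w' \<noteq> []" by (auto simp: walks_def)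
  then show "w \<in> walks E u (Suc m)" using w by (auto simp: walks_def steps_Cons)
qed

lemma card_walks_le:
  assumes E: "E \<in> regular_graphs n k"
  shows "finite (walks E u m) \<and> card (walks E u m) \<le> k ^ m"
proof (induction m)
  case (Suc m)
  have nb: "{v. (v, w) \<in> E} = E `` {w}" for w
    using regular_graphsD(3)[OF E] by (auto dest: symD)
  have fin: "finite (walks E u (Suc m))"
    unfolding walks_Suc nb using Suc regular_graphsD(6)[OF E] by auto
  have "card (walks E u (Suc m)) \<le> (\<Sum>w\<in>walks E u m. card ((\<lambda>v. v # w) ` {v. (v, hd w) \<in> E}))"
    unfolding walks_Suc using Suc by (intro card_UN_le) simp
  also have "\<dots> \<le> (\<Sum>w\<in>walks E u m. k)"
    unfolding nb using degree_le[OF E] regular_graphsD(6)[OF E]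
    by (intro sum_mono order_trans[OF card_image_le]) auto
  also have "\<dots> \<le> k ^ Suc m" using Suc by simp
  finally show ?case using fin by simp
qed (simp add: walks_0)

definition short_walks :: "nat rel \<Rightarrow> nat \<Rightarrow> nat \<Rightarrow> nat list set" where
  "short_walks E u l = (\<Union>m\<le>l. walks E u m)"

lemma card_short_walks_le:
  assumes E: "E \<in> regular_graphs n k"
  shows "finite (short_walks E u l)" "card (short_walks E u l) \<le> (\<Sum>m\<le>l. k ^ m)"
proof -
  show "finite (short_walks E u l)" using card_walks_le[OF E] by (auto simp: short_walks_def)
  show "card (short_walks E u l) \<le> (\<Sum>m\<le>l. k ^ m)"
    unfolding short_walks_def using card_walks_le[OF E]
    by (intro order_trans[OF card_UN_le] sum_mono) auto
qed

lemma set_walk: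
  assumes E: "E \<in> regular_graphs n k" and u: "u < n"
  shows "w \<in> walks E u m \<Longrightarrow> set w \<subseteq> {..<n}"
proof (induction m arbitrary: w)
  case (Suc m)
  then show ?case using regular_graphsD(1)[OF E] by (fastforce simp: walks_Suc)
qed (use u in \<open>auto simp: walks_0\<close>)

lemma card_steps_le: "card (steps w) \<le> length w - 1"
  unfolding steps_def by (rule order_trans[OF card_length]) simp

text \<open>Joining the ends of the walks \<open>P\<close> and \<open>Q\<close> adds an edge that neither of them has traversed.\<close>

definition closes_cycle :: "nat list \<Rightarrow> nat list \<Rightarrow> bool" where
  "closes_cycle P Q \<longleftrightarrow> (hd P, hd Q) \<notin> steps P \<union> steps Q \<and> (hd Q, hd P) \<notin> steps P \<union> steps Q"

text \<open>This condition is implied by the presence of a cycle in the ball of radius \<open>l\<close>. It is phrased by walks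
that may repeat vertices, so that fixing the two walks leaves a single further edge to be counted.\<close>

definition near_cycle :: "nat rel \<Rightarrow> nat \<Rightarrow> nat \<Rightarrow> bool" where
  "near_cycle E u l \<longleftrightarrow> (\<exists>P\<in>short_walks E u l. \<exists>Q\<in>short_walks E u l. closes_cycle P Q \<and> (hd P, hd Q) \<in> E)"

text \<open>Sum the bound for one additional edge over all pairs of walks in the complete graph, then exchange the
sums: the expected number of pairs of walks that lie in the graph is bounded in terms of \<open>k\<close> and \<open>l\<close>.\<close>

lemma near_cycle_rare:
  assumes u: "u < n"
  shows "card {E \<in> regular_graphs n k. near_cycle E u l} * (n * k - (2 * k * (k + 1) + 4 * l))
    \<le> k\<^sup>2 * (\<Sum>m\<le>l. k ^ m)\<^sup>2 * card (regular_graphs n k)"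
proof -
  let ?R = "regular_graphs n k"
  let ?c = "n * k - (2 * k * (k + 1) + 4 * l)"
  let ?N = "\<Sum>m\<le>l. k ^ m"
  let ?F = "\<lambda>(P, Q). steps P \<union> steps Q"
  have count: "(\<Sum>x\<in>A. if P x then 1 else 0) = card {x \<in> A. P x}" if "finite A" for A :: "'a set" and P
    using sum.inter_filter[OF that, of "\<lambda>_. 1::nat" P] by simp
  define U where "U = {w. set w \<subseteq> {..<n} \<and> length w \<le> Suc l \<and> w \<noteq> [] \<and> last w = u}"
  have finU: "finite U"
    using finite_lists_length_le[of "{..<n}" "Suc l"] by (rule finite_subset[rotated]) (auto simp: U_def)
  have short: "short_walks E u l = {w \<in> U. steps w \<subseteq> E}" if "E \<in> ?R" for E
  proof
    show "short_walks E u l \<subseteq> {w \<in> U. steps w \<subseteq> E}"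
      using set_walk[OF that u] by (fastforce simp: short_walks_def U_def walks_def)
    show "{w \<in> U. steps w \<subseteq> E} \<subseteq> short_walks E u l"
    proof
      fix w assume "w \<in> {w \<in> U. steps w \<subseteq> E}"
      then show "w \<in> short_walks E u l"
        by (cases "length w") (auto simp: U_def short_walks_def walks_def)
    qed
  qed
  define Z where "Z = {(P, Q) \<in> U \<times> U. closes_cycle P Q}"
  have finZ: "finite Z" using finU by (auto simp: Z_def intro: finite_subset[of _ "U \<times> U"])
  have "{E \<in> ?R. near_cycle E u l} \<subseteq> (\<Union>z\<in>Z. {E \<in> ?R. ?F z \<subseteq> E \<and> (hd (fst z), hd (snd z)) \<in> E})"
    by (force simp: near_cycle_def short Z_def)
  then have "card {E \<in> ?R. near_cycle E u l} \<le> card (\<Union>z\<in>Z. {E \<in> ?R. ?F z \<subseteq> E \<and> (hd (fst z), hd (snd z)) \<in> E})"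
    using finZ finite_regular_graphs by (intro card_mono) auto
  also have "\<dots> \<le> (\<Sum>z\<in>Z. card {E \<in> ?R. ?F z \<subseteq> E \<and> (hd (fst z), hd (snd z)) \<in> E})"
    using finZ by (rule card_UN_le)
  finally have "card {E \<in> ?R. near_cycle E u l} * ?c
     \<le> (\<Sum>z\<in>Z. card {E \<in> ?R. ?F z \<subseteq> E \<and> (hd (fst z), hd (snd z)) \<in> E}) * ?c"
    by (rule mult_le_mono1)
  also have "\<dots> = (\<Sum>z\<in>Z. card {E \<in> ?R. ?F z \<subseteq> E \<and> (hd (fst z), hd (snd z)) \<in> E} * ?c)"
    by (rule sum_distrib_right)
  also have "\<dots> \<le> (\<Sum>z\<in>Z. k\<^sup>2 * card {E \<in> ?R. ?F z \<subseteq> E})"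
  proof (rule sum_mono)
    fix z assume z: "z \<in> Z"
    obtain P Q where PQ: "z = (P, Q)" by (cases z)
    have "card (steps P) \<le> l" "card (steps Q) \<le> l"
      using z card_steps_le[of P] card_steps_le[of Q] by (auto simp: PQ Z_def U_def)
    then have "card (steps P \<union> steps Q) \<le> 2 * l" using card_Un_le[of "steps P" "steps Q"] by linarith
    then have "?c \<le> n * k - (2 * k * (k + 1) + 2 * card (steps P \<union> steps Q))" by (intro diff_le_mono2) simp
    then have "card {E \<in> ?R. ?F z \<subseteq> E \<and> (hd P, hd Q) \<in> E} * ?c
       \<le> card {E \<in> ?R. steps P \<union> steps Q \<subseteq> E \<and> (hd P, hd Q) \<in> E} * (n * k - (2 * k * (k + 1) + 2 * card (steps P \<union> steps Q)))"
      by (simp add: PQ)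
    also have "\<dots> \<le> k\<^sup>2 * card {E \<in> ?R. steps P \<union> steps Q \<subseteq> E}"
      using z by (intro extra_edge_rare) (auto simp: PQ Z_def closes_cycle_def steps_def)
    finally show "card {E \<in> ?R. ?F z \<subseteq> E \<and> (hd (fst z), hd (snd z)) \<in> E} * ?c
       \<le> k\<^sup>2 * card {E \<in> ?R. ?F z \<subseteq> E}" by (simp add: PQ)
  qed
  also have "\<dots> = k\<^sup>2 * (\<Sum>z\<in>Z. \<Sum>E\<in>?R. if ?F z \<subseteq> E then 1 else 0)"
    by (simp only: count[OF finite_regular_graphs] sum_distrib_left)
  also have "\<dots> = k\<^sup>2 * (\<Sum>E\<in>?R. \<Sum>z\<in>Z. if ?F z \<subseteq> E then 1 else 0)"
    by (subst sum.swap) simp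
  also have "\<dots> \<le> k\<^sup>2 * (\<Sum>E\<in>?R. ?N\<^sup>2)"
  proof (intro mult_le_mono2 sum_mono)
    fix E assume E: "E \<in> ?R"
    have "(\<Sum>z\<in>Z. if ?F z \<subseteq> E then 1 else 0) = card {z \<in> Z. ?F z \<subseteq> E}"
      by (rule count[OF finZ])
    also have "\<dots> \<le> card (short_walks E u l \<times> short_walks E u l)"
    proof (rule card_mono)
      show "finite (short_walks E u l \<times> short_walks E u l)"
        using card_short_walks_le(1)[OF E] by (intro finite_cartesian_product)
    qed (auto simp: Z_def short[OF E])
    also have "\<dots> \<le> ?N\<^sup>2"
      using card_short_walks_le(2)[OF E]
      by (simp add: card_cartesian_product power2_eq_square mult_le_mono)
    finally show "(\<Sum>z\<in>Z. if ?F z \<subseteq> E then 1 else 0) \<le> ?N\<^sup>2" .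
  qed
  also have "\<dots> = k\<^sup>2 * ?N\<^sup>2 * card ?R" by simp
  finally show ?thesis .
qed

lemma near_cycle_probability_le:
  obtains K n0 where "\<And>n u. n0 \<le> n \<Longrightarrow> u < n \<Longrightarrow>
    real (card {E \<in> regular_graphs n k. near_cycle E u l}) \<le> K / real n * real (card (regular_graphs n k))"
proof (cases "k = 0")
  case True
  have "card {E \<in> regular_graphs n k. near_cycle E u l} = 0" for n u
  proof -
    have "E = {}" if "E \<in> regular_graphs n k" for E
      using card_regular_graph[OF that] regular_graphsD(2)[OF that] True by simp
    then have "{E \<in> regular_graphs n k. near_cycle E u l} = {}" by (auto simp: near_cycle_def)
    then show ?thesis by (simp only: card.empty)
  qed
  then show ?thesis using that[of 0 0] by simp
next
  case False
  define c where "c = 2 * k * (k + 1) + 4 * l"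
  define N where "N = k\<^sup>2 * (\<Sum>m\<le>l. k ^ m)\<^sup>2"
  show ?thesis
  \<comment> \<open>For \<open>n > 2 c\<close> the factor \<open>n k - c\<close> is at least \<open>n / 2\<close>.\<close>
  proof (rule that[of "2 * c + 1" "2 * real N"])
    fix n u assume n: "2 * c + 1 \<le> n" and u: "u < n"
    let ?b = "card {E \<in> regular_graphs n k. near_cycle E u l}"
    have "n \<le> n * k" using False by simp
    then have "n \<le> 2 * (n * k - c)" using n by linarith
    then have "?b * n \<le> 2 * (?b * (n * k - c))"
      using mult_le_mono2[of n "2 * (n * k - c)" ?b] by simp
    also have "\<dots> \<le> 2 * (N * card (regular_graphs n k))"
      using near_cycle_rare[OF u, of k l] by (simp add: N_def c_def)
    finally have "real (?b * n) \<le> real (2 * (N * card (regular_graphs n k)))"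
      by (simp only: of_nat_le_iff)
    then show "real ?b \<le> 2 * real N / real n * real (card (regular_graphs n k))"
      using n by (simp add: field_simps)
  qed
qed

lemma mem_graph_ball: "v \<in> graph_ball E u l \<longleftrightarrow> (\<exists>m\<le>l. (u, v) \<in> E ^^ m)"
proof
  assume v: "v \<in> graph_ball E u l"
  show "\<exists>m\<le>l. (u, v) \<in> E ^^ m"
  proof (rule ccontr)
    assume "\<not> (\<exists>m\<le>l. (u, v) \<in> E ^^ m)"
    then have "enat (Suc l) \<le> graph_dist E u v"
      unfolding graph_dist_def by (intro INF_greatest) (auto simp: not_le Suc_le_eq)
    moreover have "graph_dist E u v \<le> enat l" using v by (simp add: graph_ball_def)
    ultimately have "enat (Suc l) \<le> enat l" by (rule order_trans)
    then show False by simp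
  qed
next
  assume "\<exists>m\<le>l. (u, v) \<in> E ^^ m"
  then obtain m where m: "m \<le> l" "(u, v) \<in> E ^^ m" by blast
  then have "graph_dist E u v \<le> enat m" unfolding graph_dist_def by (intro INF_lower) simp
  then show "v \<in> graph_ball E u l" using m by (auto simp: graph_ball_def intro: order_trans)
qed

text \<open>Depth is the distance from \<open>u\<close>, and the parent is any neighbour that is closer to \<open>u\<close>. Following parents
gives a walk from \<open>u\<close> to each vertex of the ball. If an edge of the ball did not join a vertex to its
parent, then neither of the walks to its two ends would use it.\<close>

lemma good_ball_tree:
  assumes E: "E \<in> regular_graphs n k" and D: "orientation_of E D" and u: "u < n"
    and good: "\<not> near_cycle E u l"
  obtains parent depth where "rooted_tree (graph_ball E u l) u parent depth D"
    "\<And>v. v \<in> graph_ball E u l \<Longrightarrow> v \<noteq> u \<Longrightarrow> (parent v, v) \<in> E"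
proof -
  note E' = regular_graphsD[OF E]
  let ?B = "graph_ball E u l"
  define depth where "depth = (\<lambda>v. LEAST m. (u, v) \<in> E ^^ m)"
  define parent where "parent = (\<lambda>v. SOME w. (u, w) \<in> E ^^ (depth v - 1) \<and> (w, v) \<in> E)"
  have reach: "(u, v) \<in> E ^^ depth v" and least: "depth v \<le> m" if "(u, v) \<in> E ^^ m" for v m
    unfolding depth_def using that by (auto intro: LeastI Least_le)
  have pred: "(u, parent v) \<in> E ^^ (depth v - 1) \<and> (parent v, v) \<in> E \<and> depth v = Suc (depth (parent v))"
    if v: "(u, v) \<in> E ^^ m" "v \<noteq> u" for v m
  proof -
    obtain j where j: "depth v = Suc j" using reach[OF v(1)] v(2) by (cases "depth v") auto
    then obtain w where "(u, w) \<in> E ^^ j" "(w, v) \<in> E" using reach[OF v(1)] by auto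
    then have "\<exists>w. (u, w) \<in> E ^^ (depth v - 1) \<and> (w, v) \<in> E" using j by auto
    then have P: "(u, parent v) \<in> E ^^ (depth v - 1)" "(parent v, v) \<in> E"
      unfolding parent_def by (metis (mono_tags, lifting) someI_ex)+
    have "(u, v) \<in> E ^^ Suc (depth (parent v))" using reach[OF P(1)] P(2) by auto
    then have "depth v \<le> Suc (depth (parent v))" by (rule least)
    moreover have "depth (parent v) \<le> depth v - 1" by (rule least[OF P(1)])
    ultimately show ?thesis using P j by simp
  qed
  have ball: "v \<in> ?B \<longleftrightarrow> (\<exists>m. (u, v) \<in> E ^^ m) \<and> depth v \<le> l" for v
    unfolding mem_graph_ball using least[of v] reach[of v] le_trans by blast
  have walk: "\<exists>w\<in>walks E u (depth v). hd w = v \<and> (\<forall>(a, b)\<in>steps w. a \<noteq> u \<and> b = parent a)"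
    if "(u, v) \<in> E ^^ m" for v m
    using that
  proof (induction "depth v" arbitrary: v m rule: less_induct)
    case less
    show ?case
    proof (cases "v = u")
      case True
      have "depth u \<le> 0" by (rule least) simp
      then show ?thesis using True by (auto simp: walks_0 steps_def)
    next
      case False
      note P = pred[OF less.prems False]
      obtain w where w: "w \<in> walks E u (depth (parent v))" "hd w = parent v"
        "\<forall>(a, b)\<in>steps w. a \<noteq> u \<and> b = parent a"
        using less.hyps[of "parent v" "depth v - 1"] P by auto
      have "w \<noteq> []" using w by (auto simp: walks_def)
      moreover have "(v, parent v) \<in> E" using P E'(3) by (auto dest: symD)
      then have "v # w \<in> walks E u (Suc (depth (parent v)))"
        unfolding walks_Suc by (intro UN_I[OF w(1)]) (use w(2) in auto)
      then have "v # w \<in> walks E u (depth v)" using P by simp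
      ultimately show ?thesis using w False
        by (intro bexI[of _ "v # w"]) (auto simp: steps_Cons)
    qed
  qed
  have sub: "?B \<subseteq> {..<n}"
  proof
    fix v assume "v \<in> ?B"
    then obtain m where "(u, v) \<in> E ^^ m" by (auto simp: mem_graph_ball)
    then show "v \<in> {..<n}" using pred[of v] u E'(1) by (cases "v = u") auto
  qed
  have DE: "D \<union> D\<inverse> = E" "D \<inter> D\<inverse> = {}" using D by (auto simp: orientation_of_def)
  have "rooted_tree ?B u parent depth D"
  proof
    show "finite ?B" using sub by (rule finite_subset) simp
    show "u \<in> ?B" unfolding mem_graph_ball by (intro exI[of _ 0]) simp
    show "parent x \<in> ?B" if "x \<in> ?B" "x \<noteq> u" for x
      using that pred[of x] unfolding ball by fastforce
    show "depth x = Suc (depth (parent x))" if "x \<in> ?B" "x \<noteq> u" for x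
      using that pred[of x] unfolding ball by blast
    show "((x, parent x) \<in> D) \<noteq> ((parent x, x) \<in> D)" if x: "x \<in> ?B" "x \<noteq> u" for x
    proof -
      have "(parent x, x) \<in> E" using x pred[of x] unfolding ball by blast
      then show ?thesis using DE by blast
    qed
    fix a b assume ab: "(a, b) \<in> D" "a \<in> ?B" "b \<in> ?B"
    obtain P where P: "P \<in> short_walks E u l" "hd P = a" "\<forall>(a, b)\<in>steps P. a \<noteq> u \<and> b = parent a"
      using walk[of a] ab(2) unfolding ball short_walks_def by blast
    obtain Q where Q: "Q \<in> short_walks E u l" "hd Q = b" "\<forall>(a, b)\<in>steps Q. a \<noteq> u \<and> b = parent a"
      using walk[of b] ab(3) unfolding ball short_walks_def by blast
    have "(a, b) \<in> E" using ab DE by blast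
    then have "\<not> closes_cycle P Q" using good P Q unfolding near_cycle_def by blast
    then show "b \<noteq> u \<and> a = parent b \<or> a \<noteq> u \<and> b = parent a"
      using P Q unfolding closes_cycle_def by blast
  qed
  moreover have "(parent v, v) \<in> E" if "v \<in> ?B" "v \<noteq> u" for v
    using that pred[of v] unfolding ball by blast
  ultimately show ?thesis by (rule that)
qed

section \<open>The random regular graph\<close>

lemma finite_set_sync_pmf: "0 < q \<Longrightarrow> finite D \<Longrightarrow> finite (set_pmf (sync_pmf q p \<epsilon> n D))"
  unfolding sync_pmf_def set_bind_pmf
  by (intro finite_UN_I finite_set_Pi_pmf)
     (auto intro: finite_set_edge_channel finite_set_erasure_channel simp: set_pmf_Zmod)

text \<open>Choice of constants: \<open>\<eta>\<close> is small enough that \<open>\<kappa> = (1 + \<eta>)^(k - 1) (k - 1) (1 - p)\<^sup>2\<close> stays below \<open>1\<close>,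
and \<open>c\<close> is such that the fixed point \<open>\<epsilon> q / (1 - \<kappa>)\<close> remains below the threshold for first-order
additivity.\<close>

lemma posterior_error_le_on_tree_like:
  fixes k q :: nat and p :: real
  assumes q: "0 < q" and p: "0 \<le> p" "p \<le> 1" and KS: "(1 - p)\<^sup>2 * (real k - 1) < 1"
  obtains c C where "0 < c" "0 < C"
    "\<And>\<epsilon> n E D u l. 0 \<le> \<epsilon> \<Longrightarrow> \<epsilon> \<le> 1 \<Longrightarrow> \<epsilon> \<le> c \<Longrightarrow> E \<in> regular_graphs n k \<Longrightarrow>
      orientation_of E D \<Longrightarrow> u < n \<Longrightarrow> \<not> near_cycle E u l \<Longrightarrow>
      measure_pmf.expectation (sync_pmf q p \<epsilon> n D)
        (\<lambda>\<omega>. (d_TV (Zmod q) (posterior q p \<epsilon> n E D u l \<omega>) (pmf (pmf_of_set (Zmod q))))\<^sup>2) \<le> C * \<epsilon>"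
proof -
  define \<kappa>0 where "\<kappa>0 = real (k - 1) * (1 - p)\<^sup>2"
  \<comment> \<open>For \<open>k = 0\<close> the natural number \<open>k - 1\<close> is \<open>0\<close>, and \<open>\<kappa>0\<close> vanishes.\<close>
  have \<kappa>0: "\<kappa>0 < 1"
  proof (cases "k = 0")
    case False
    then show ?thesis using KS by (simp add: \<kappa>0_def of_nat_diff mult.commute)
  qed (simp add: \<kappa>0_def)
  have "((\<lambda>\<eta>. (1 + \<eta>) ^ (k - 1) * \<kappa>0) \<longlongrightarrow> (1 + 0) ^ (k - 1) * \<kappa>0) (at_right 0)"
    by (intro tendsto_intros)
  then have "eventually (\<lambda>\<eta>. (1 + \<eta>) ^ (k - 1) * \<kappa>0 < 1) (at_right 0)"
    using \<kappa>0 by (intro order_tendstoD(2)) auto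
  then have "eventually (\<lambda>\<eta>. (1 + \<eta>) ^ (k - 1) * \<kappa>0 < 1 \<and> 0 < \<eta>) (at_right (0::real))"
    by (intro eventually_conj eventually_at_right_less)
  then obtain \<eta> where \<eta>: "0 < \<eta>" "(1 + \<eta>) ^ (k - 1) * \<kappa>0 < 1"
    using eventually_happens'[OF trivial_limit_at_right_real] by blast
  define \<kappa> where "\<kappa> = (1 + \<eta>) ^ (k - 1) * \<kappa>0"
  define A where "A = real q / (1 - \<kappa>)"
  have A: "0 < A" using q \<eta> by (simp add: A_def \<kappa>_def)
  obtain b where b: "0 < b" and merge: "\<And>(M :: int \<Rightarrow> obs pmf) (N :: int \<Rightarrow> obs pmf).
      (\<And>x. x \<in> Zmod q \<Longrightarrow> finite (set_pmf (M x))) \<Longrightarrow> (\<And>x. x \<in> Zmod q \<Longrightarrow> finite (set_pmf (N x))) \<Longrightarrow>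
      chi2 q N \<le> b \<Longrightarrow> chi2 q (\<lambda>x. pair_pmf (M x) (N x)) \<le> (1 + \<eta>) * (chi2 q M + chi2 q N)"
    by (rule chi2_pair_small[OF q \<eta>(1)]) blast
  define C where "C = real q + (1 + \<eta>) ^ k * (real k * ((1 - p)\<^sup>2 * A))"
  have C: "0 < C" unfolding C_def using q \<eta> A by (intro add_pos_nonneg) auto
  show ?thesis
  proof (rule that[of "b / A" C])
    show "0 < b / A" using b A by simp
    show "0 < C" by (rule C)
    fix \<epsilon> n E D u l
    assume \<epsilon>: "0 \<le> \<epsilon>" "\<epsilon> \<le> 1" "\<epsilon> \<le> b / A" and E: "E \<in> regular_graphs n k"
      and D: "orientation_of E D" and u: "u < n" and good: "\<not> near_cycle E u l"
    note E' = regular_graphsD[OF E]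
    let ?B = "graph_ball E u l"
    obtain parent depth where tree: "rooted_tree ?B u parent depth D"
      and parent: "\<And>v. v \<in> ?B \<Longrightarrow> v \<noteq> u \<Longrightarrow> (parent v, v) \<in> E"
      by (rule good_ball_tree[OF E D u good]) (rule that, assumption, blast)
    interpret rooted_tree ?B u parent depth D by (rule tree)
    have DE: "D \<subseteq> E" using D by (auto simp: orientation_of_def)
    then have finD: "finite D" using E'(2) by (rule finite_subset)
    have Bn: "?B \<subseteq> {..<n}"
    proof
      fix v assume "v \<in> ?B"
      then show "v \<in> {..<n}" using parent[of v] E'(1) u by (cases "v = u") auto
    qed
    let ?M = "obs_law q p \<epsilon> ?B ?B (D \<inter> ?B \<times> ?B) u"
    let ?M' = "\<lambda>x. map_pmf (restrict_obs ?B (D \<inter> ?B \<times> ?B)) (?M x)"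
    have fin: "finite (set_pmf (?M x))" for x
      using finite_B finD q by (intro finite_set_obs_law) auto
    have ch: "children v \<subseteq> E `` {v}" for v
      using parent by (auto simp: children_def)
    have small: "(1 - p)\<^sup>2 * (\<epsilon> * real q / (1 - \<kappa>)) \<le> b"
    proof -
      have "(1 - p)\<^sup>2 \<le> 1" using p by (simp add: power_le_one)
      then have "(1 - p)\<^sup>2 * (\<epsilon> * A) \<le> 1 * (\<epsilon> * A)"
        using \<epsilon> A by (intro mult_right_mono) auto
      also have "\<dots> \<le> b" using \<epsilon> A by (simp add: field_simps)
      finally show ?thesis by (simp add: A_def)
    qed
    have "measure_pmf.expectation (sync_pmf q p \<epsilon> n D)
        (\<lambda>\<omega>. (d_TV (Zmod q) (posterior q p \<epsilon> n E D u l \<omega>) (pmf (pmf_of_set (Zmod q))))\<^sup>2) \<le> chi2 q ?M'"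
      unfolding posterior_def[abs_def]
      using fin by (intro expected_sq_TV_le_chi2 q sync_local_law finD Bn root_in) simp
    also have "\<dots> \<le> chi2 q ?M" by (rule chi2_map_le[OF q fin])
    also have "\<dots> \<le> \<epsilon> * real q + (1 + \<eta>) ^ k * (real k * ((1 - p)\<^sup>2 * (\<epsilon> * real q / (1 - \<kappa>))))"
    proof (rule chi2_root_le[OF q p \<epsilon>(1,2) _ merge _ _ _ _ small])
      show "0 \<le> \<eta>" using \<eta> by simp
      show "card (children u) \<le> k"
        using card_mono[OF E'(6) ch[of u]] degree_le[OF E, of u] by simp
      show "card (children v) \<le> k - 1" if v: "v \<in> ?B" "v \<noteq> u" for v
      proof -
        have "parent v \<notin> children v"
          using depth_children[of "parent v" v] depth_parent[OF v] by auto
        then have "children v \<subseteq> E `` {v} - {parent v}" using ch by auto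
        moreover have "parent v \<in> E `` {v}" using parent[OF v] E'(3) by (auto dest: symD)
        then have "card (E `` {v} - {parent v}) \<le> k - 1"
          using degree_le[OF E, of v] E'(6) by simp
        ultimately show ?thesis using card_mono[of "E `` {v} - {parent v}" "children v"] E'(6) by fastforce
      qed
      show "(1 + \<eta>) ^ (k - 1) * (real (k - 1) * (1 - p)\<^sup>2) \<le> \<kappa>" by (simp add: \<kappa>_def \<kappa>0_def)
      show "\<kappa> < 1" using \<eta> by (simp add: \<kappa>_def)
    qed
    also have "\<dots> = C * \<epsilon>" by (simp add: C_def A_def algebra_simps)
    finally show "measure_pmf.expectation (sync_pmf q p \<epsilon> n D)
        (\<lambda>\<omega>. (d_TV (Zmod q) (posterior q p \<epsilon> n E D u l \<omega>) (pmf (pmf_of_set (Zmod q))))\<^sup>2) \<le> C * \<epsilon>" .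
  qed
qed

lemma posterior_error_le_trivial:
  assumes q: "0 < q" and D: "finite D"
  shows "measure_pmf.expectation (sync_pmf q p \<epsilon> n D)
    (\<lambda>\<omega>. (d_TV (Zmod q) (posterior q p \<epsilon> n E D u l \<omega>) (pmf (pmf_of_set (Zmod q))))\<^sup>2) \<le> (real q)\<^sup>2"
proof -
  have post: "0 \<le> posterior q p \<epsilon> n E D u l \<omega> x \<and> posterior q p \<epsilon> n E D u l \<omega> x \<le> 1" for \<omega> x
    unfolding posterior_def cond_prob_def
    by (auto intro!: divide_le_eq_1[THEN iffD2] measure_pmf.finite_measure_mono simp: zero_less_measure_iff)
  have unif: "0 \<le> pmf P x \<and> pmf P x \<le> 1" for P :: "int pmf" and x by (simp add: pmf_le_1)
  have TV: "(d_TV (Zmod q) (posterior q p \<epsilon> n E D u l \<omega>) (pmf (pmf_of_set (Zmod q))))\<^sup>2 \<le> (real q)\<^sup>2" for \<omega>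
  proof (rule power_mono)
    have "\<bar>posterior q p \<epsilon> n E D u l \<omega> x - pmf (pmf_of_set (Zmod q)) x\<bar> \<le> 1" for x
      using post[of \<omega> x] unif[of "pmf_of_set (Zmod q)" x] by (smt (verit))
    then have "(\<Sum>x\<in>Zmod q. \<bar>posterior q p \<epsilon> n E D u l \<omega> x - pmf (pmf_of_set (Zmod q)) x\<bar>) \<le> (\<Sum>x\<in>Zmod q. 1)"
      by (intro sum_mono)
    then show "d_TV (Zmod q) (posterior q p \<epsilon> n E D u l \<omega>) (pmf (pmf_of_set (Zmod q))) \<le> real q"
      by (simp add: d_TV_def)
  qed (simp add: d_TV_def sum_nonneg)
  have "measure_pmf.expectation (sync_pmf q p \<epsilon> n D)
      (\<lambda>\<omega>. (d_TV (Zmod q) (posterior q p \<epsilon> n E D u l \<omega>) (pmf (pmf_of_set (Zmod q))))\<^sup>2)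
    \<le> measure_pmf.expectation (sync_pmf q p \<epsilon> n D) (\<lambda>_. (real q)\<^sup>2)"
    using finite_set_sync_pmf[OF q D] TV by (intro integral_mono integrable_measure_pmf_finite)
  then show ?thesis by simp
qed

text \<open>Vertices whose ball is not a tree are given the trivial bound \<open>q\<^sup>2\<close>.\<close>

lemma mean_square_TV_le:
  assumes q: "0 < q" and n: "0 < n" and R: "regular_graphs n k \<noteq> {}"
    and dir: "\<And>E. E \<in> regular_graphs n k \<Longrightarrow> orientation_of E (dir E)"
    and good: "\<And>E u. E \<in> regular_graphs n k \<Longrightarrow> u < n \<Longrightarrow> \<not> near_cycle E u l \<Longrightarrow>
      measure_pmf.expectation (sync_pmf q p \<epsilon> n (dir E))
        (\<lambda>\<omega>. (d_TV (Zmod q) (posterior q p \<epsilon> n E (dir E) u l \<omega>) (pmf (pmf_of_set (Zmod q))))\<^sup>2) \<le> B"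
    and B: "0 \<le> B"
    and bad: "\<And>u. u < n \<Longrightarrow> real (card {E \<in> regular_graphs n k. near_cycle E u l}) \<le> \<beta> * real (card (regular_graphs n k))"
  shows "mean_square_TV k q p \<epsilon> n dir l \<le> B + (real q)\<^sup>2 * \<beta>"
proof -
  let ?R = "regular_graphs n k"
  let ?f = "\<lambda>u (E, \<omega>). (d_TV (Zmod q) (posterior q p \<epsilon> n E (dir E) u l \<omega>) (pmf (pmf_of_set (Zmod q))))\<^sup>2"
  let ?r = "real (card ?R)"
  have finR: "finite ?R" by (rule finite_regular_graphs)
  have r: "0 < ?r" using R finR by (simp add: card_gt_0_iff)
  have finD: "finite (dir E)" if "E \<in> ?R" for E
    using dir[OF that] by (intro finite_subset[OF _ regular_graphsD(2)[OF that]]) (auto simp: orientation_of_def)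
  have fin: "finite (set_pmf (sync_pmf q p \<epsilon> n (dir E)))" if "E \<in> ?R" for E
    by (rule finite_set_sync_pmf[OF q finD[OF that]])
  have vertex: "measure_pmf.expectation (random_regular_sync_pmf k q p \<epsilon> n dir) (?f u) \<le> B + (real q)\<^sup>2 * \<beta>"
    if u: "u < n" for u
  proof -
    have rr: "random_regular_sync_pmf k q p \<epsilon> n dir
        = bind_pmf (pmf_of_set ?R) (\<lambda>E. map_pmf (Pair E) (sync_pmf q p \<epsilon> n (dir E)))"
      by (simp add: random_regular_sync_pmf_def map_pmf_def)
    have "measure_pmf.expectation (random_regular_sync_pmf k q p \<epsilon> n dir) (?f u)
        = (\<Sum>E\<in>?R. measure_pmf.expectation (sync_pmf q p \<epsilon> n (dir E)) (\<lambda>\<omega>. ?f u (E, \<omega>))) / ?r"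
      unfolding rr using R finR fin
      by (subst pmf_expectation_bind_pmf_of_set) (auto simp: divide_inverse mult.commute sum_distrib_left)
    also have "\<dots> \<le> (\<Sum>E\<in>?R. B + (if near_cycle E u l then (real q)\<^sup>2 else 0)) / ?r"
    proof (intro divide_right_mono sum_mono)
      fix E assume E: "E \<in> ?R"
      show "measure_pmf.expectation (sync_pmf q p \<epsilon> n (dir E)) (\<lambda>\<omega>. ?f u (E, \<omega>))
        \<le> B + (if near_cycle E u l then (real q)\<^sup>2 else 0)"
        using good[OF E u] posterior_error_le_trivial[OF q finD[OF E], of p \<epsilon> n E u l] B by simp
    qed simp
    also have "(\<Sum>E\<in>?R. B + (if near_cycle E u l then (real q)\<^sup>2 else 0))
      = ?r * B + (real q)\<^sup>2 * real (card {E \<in> ?R. near_cycle E u l})"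
      using sum.inter_filter[OF finR, of "\<lambda>_. (real q)\<^sup>2" "\<lambda>E. near_cycle E u l"]
      by (simp add: sum.distrib mult.commute)
    also have "\<dots> / ?r \<le> (?r * B + (real q)\<^sup>2 * (\<beta> * ?r)) / ?r"
      by (intro divide_right_mono add_left_mono mult_left_mono bad u) auto
    also have "\<dots> = B + (real q)\<^sup>2 * \<beta>" using r by (simp add: field_simps)
    finally show ?thesis .
  qed
  have "mean_square_TV k q p \<epsilon> n dir l \<le> 1 / real n * (\<Sum>u<n. B + (real q)\<^sup>2 * \<beta>)"
    unfolding mean_square_TV_def by (intro mult_left_mono sum_mono vertex) auto
  also have "\<dots> = B + (real q)\<^sup>2 * \<beta>" using n by simp
  finally show ?thesis .
qed

theorem theoremD:
  fixes k q :: nat and p :: real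
  assumes "0 < q" and "0 \<le> p" and "p \<le> 1"
  shows "\<exists>c>0. \<exists>C>0. (1 - p)\<^sup>2 * (real k - 1) < 1 \<longrightarrow>
    (\<forall>\<epsilon>::real. \<forall>dir :: nat \<Rightarrow> nat rel \<Rightarrow> nat rel.
      0 \<le> \<epsilon> \<longrightarrow> \<epsilon> \<le> 1 \<longrightarrow> \<epsilon> \<le> c \<longrightarrow>
      (\<forall>n. \<forall>E\<in>regular_graphs n k. orientation_of E (dir n E)) \<longrightarrow>
      limsup (\<lambda>l. Limsup (admissible_sizes k)
        (\<lambda>n. ereal (mean_square_TV k q p \<epsilon> n (dir n) l))) \<le> ereal (C * \<epsilon>))"
proof (cases "(1 - p)\<^sup>2 * (real k - 1) < 1")
  case False
  then show ?thesis by (intro exI[of _ "1::real"] conjI impI) simp_all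
next
  case True
  obtain c C where c: "0 < c" and C: "0 < C" and good:
    "\<And>\<epsilon> n E D u l. 0 \<le> \<epsilon> \<Longrightarrow> \<epsilon> \<le> 1 \<Longrightarrow> \<epsilon> \<le> c \<Longrightarrow> E \<in> regular_graphs n k \<Longrightarrow>
      orientation_of E D \<Longrightarrow> u < n \<Longrightarrow> \<not> near_cycle E u l \<Longrightarrow>
      measure_pmf.expectation (sync_pmf q p \<epsilon> n D)
        (\<lambda>\<omega>. (d_TV (Zmod q) (posterior q p \<epsilon> n E D u l \<omega>) (pmf (pmf_of_set (Zmod q))))\<^sup>2) \<le> C * \<epsilon>"
    by (rule posterior_error_le_on_tree_like[OF assms True]) blast
  have "limsup (\<lambda>l. Limsup (admissible_sizes k)
      (\<lambda>n. ereal (mean_square_TV k q p \<epsilon> n (dir n) l))) \<le> ereal (C * \<epsilon>)"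
    if \<epsilon>: "0 \<le> \<epsilon>" "\<epsilon> \<le> 1" "\<epsilon> \<le> c"
      and dir: "\<forall>n. \<forall>E\<in>regular_graphs n k. orientation_of E (dir n E)"
    for \<epsilon> and dir :: "nat \<Rightarrow> nat rel \<Rightarrow> nat rel"
  proof (rule Limsup_bounded, rule always_eventually, rule allI, rule ereal_le_epsilon2)
    fix l and \<delta> :: real assume \<delta>: "0 < \<delta>"
    obtain K n0 where bad: "\<And>n u. n0 \<le> n \<Longrightarrow> u < n \<Longrightarrow>
      real (card {E \<in> regular_graphs n k. near_cycle E u l}) \<le> K / real n * real (card (regular_graphs n k))"
      by (rule near_cycle_probability_le[of k l]) (rule that, blast)
    have "(\<lambda>n. (real q)\<^sup>2 * (K / real n)) \<longlonglongrightarrow> (real q)\<^sup>2 * 0"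
      by (intro tendsto_intros lim_const_over_n)
    then have "eventually (\<lambda>n. (real q)\<^sup>2 * (K / real n) < \<delta>) sequentially"
      using \<delta> by (intro order_tendstoD(2)) auto
    then have "eventually (\<lambda>n. even (n * k) \<longrightarrow> mean_square_TV k q p \<epsilon> n (dir n) l \<le> C * \<epsilon> + \<delta>) sequentially"
      using eventually_ge_at_top[of n0] eventually_gt_at_top[of k]
    proof eventually_elim
      case (elim n)
      show ?case
      proof
        assume "even (n * k)"
        then have "regular_graphs n k \<noteq> {}" using elim by (intro regular_graphs_nonempty) auto
        then have "mean_square_TV k q p \<epsilon> n (dir n) l \<le> C * \<epsilon> + (real q)\<^sup>2 * (K / real n)"
          using elim dir \<epsilon> C by (intro mean_square_TV_le[where k = k] assms(1) good bad) auto
        then show "mean_square_TV k q p \<epsilon> n (dir n) l \<le> C * \<epsilon> + \<delta>" using elim by simp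
      qed
    qed
    then have "eventually (\<lambda>n. ereal (mean_square_TV k q p \<epsilon> n (dir n) l) \<le> ereal (C * \<epsilon>) + ereal \<delta>)
        (admissible_sizes k)"
      by (simp add: admissible_sizes_def eventually_inf_principal)
    then show "Limsup (admissible_sizes k) (\<lambda>n. ereal (mean_square_TV k q p \<epsilon> n (dir n) l))
        \<le> ereal (C * \<epsilon>) + ereal \<delta>"
      by (rule Limsup_bounded)
  qed
  then show ?thesis using c C by blast
qed

end
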